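(* Let $E$ be any elliptic curve defined over $\mathbb{R}$ (so that its $j$-invariant is a real number). Then there is a real number $a\notin\{0,-1,-9\}$ such that $E$ is isomorphic over $\mathbb{R}$ to the curve $$E_a:\ x^2(y+z)+y^2(x+z)+z^2(x+y)+(a+3)xyz=0 .$$
   Context: For a real number $a\notin\{0,-1,-9\}$, the displayed equation defines a nonsingular plane cubic curve in the projective plane with homogeneous coordinates $(x,y,z)$. It is regarded as an elliptic curve over $\mathbb{R}$ with base point (identity of the group law) $(0,1,-1)$. *)

theory Defs
  imports "HOL-Analysis.Analysis"
begin

text \<open>
  Everything is expressed on geometric points, i.e. on the projective plane over the complex
  numbers; being defined over the reals means that all polynomials involved have real
  coefficients.
\<close>

section \<open>Real forms in three variables\<close>

text \<open>
  Forms are represented by the functions they induce on \<open>complex ^ 3\<close>; as the complex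
  numbers are infinite, nothing is lost by this. The zero form is a form of every degree.
\<close>

definition real_form :: "nat \<Rightarrow> (complex ^ 3 \<Rightarrow> complex) \<Rightarrow> bool" where
  "real_form d F \<longleftrightarrow>
     (\<exists>c :: nat \<Rightarrow> nat \<Rightarrow> nat \<Rightarrow> real. \<forall>v.
        F v = (\<Sum>(i, j, k) \<in> {(i, j, k). i + j + k = d}.
                 of_real (c i j k) * (v $ 1) ^ i * (v $ 2) ^ j * (v $ 3) ^ k))"

definition partial :: "(complex ^ 3 \<Rightarrow> complex) \<Rightarrow> 3 \<Rightarrow> complex ^ 3 \<Rightarrow> complex" where
  "partial F i v = deriv (\<lambda>t. F (\<chi> j. if j = i then t else v $ j)) (v $ i)"


section \<open>The projective plane and plane cubics\<close>

definition ppoint :: "complex ^ 3 \<Rightarrow> (complex ^ 3) set" where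
  "ppoint v = {k *s v | k. k \<noteq> 0}"

definition of_real_vec :: "real ^ 3 \<Rightarrow> complex ^ 3" where
  "of_real_vec p = (\<chi> i. of_real (p $ i))"

definition curve_points :: "(complex ^ 3 \<Rightarrow> complex) \<Rightarrow> (complex ^ 3) set set" where
  "curve_points F = {ppoint v | v. v \<noteq> 0 \<and> F v = 0}"

text \<open>Nonsingularity is a condition on all complex points, not only on the real ones.\<close>

definition nonsingular :: "(complex ^ 3 \<Rightarrow> complex) \<Rightarrow> bool" where
  "nonsingular F \<longleftrightarrow> (\<forall>v. v \<noteq> 0 \<and> F v = 0 \<longrightarrow> (\<exists>i. partial F i v \<noteq> 0))"

text \<open>
  An elliptic curve over the reals: a nonsingular plane cubic with real coefficients together
  with a real point on it, the identity of the group law, given by homogeneous coordinates.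
  The base point is not required to be a flex, so Weierstrass equations are a special case.
\<close>

definition elliptic_curve :: "(complex ^ 3 \<Rightarrow> complex) \<Rightarrow> real ^ 3 \<Rightarrow> bool" where
  "elliptic_curve F p \<longleftrightarrow>
     real_form 3 F \<and> nonsingular F \<and> p \<noteq> 0 \<and> F (of_real_vec p) = 0"


section \<open>Isomorphisms over the reals\<close>

text \<open>
  A morphism over the reals of plane curves: around every point \<open>ppoint u\<close> it is given by
  three real forms of the same degree \<open>d\<close>, namely on the Zariski open neighbourhood where these
  forms do not all vanish. Different points may need different forms.
\<close>

definition real_morphism ::
  "(complex ^ 3 \<Rightarrow> complex) \<Rightarrow> (complex ^ 3 \<Rightarrow> complex) \<Rightarrow>
   ((complex ^ 3) set \<Rightarrow> (complex ^ 3) set) \<Rightarrow> bool" where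
  "real_morphism F G \<phi> \<longleftrightarrow>
     \<phi> ` curve_points F \<subseteq> curve_points G \<and>
     (\<forall>u. u \<noteq> 0 \<and> F u = 0 \<longrightarrow>
        (\<exists>d H. (\<forall>i::3. real_form d (H i)) \<and> (\<chi> i. H i u) \<noteq> 0 \<and>
               (\<forall>v. v \<noteq> 0 \<and> F v = 0 \<and> (\<chi> i. H i v) \<noteq> 0 \<longrightarrow>
                    \<phi> (ppoint v) = ppoint (\<chi> i. H i v))))"

definition isomorphic_over_reals ::
  "(complex ^ 3 \<Rightarrow> complex) \<Rightarrow> real ^ 3 \<Rightarrow> (complex ^ 3 \<Rightarrow> complex) \<Rightarrow> real ^ 3 \<Rightarrow> bool" where
  "isomorphic_over_reals F p G q \<longleftrightarrow>
     (\<exists>\<phi> \<psi>. real_morphism F G \<phi> \<and> real_morphism G F \<psi> \<and>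
            (\<forall>P \<in> curve_points F. \<psi> (\<phi> P) = P) \<and>
            (\<forall>Q \<in> curve_points G. \<phi> (\<psi> Q) = Q) \<and>
            \<phi> (ppoint (of_real_vec p)) = ppoint (of_real_vec q))"


section \<open>The family\<close>

definition E_cubic :: "real \<Rightarrow> complex ^ 3 \<Rightarrow> complex" where
  "E_cubic a v = (let x = v $ 1; y = v $ 2; z = v $ 3 in
     x\<^sup>2 * (y + z) + y\<^sup>2 * (x + z) + z\<^sup>2 * (x + y) + (of_real a + 3) * x * y * z)"

definition E_base :: "real ^ 3" where
  "E_base = vector [0, 1, -1]"

lemma real_form_E_cubic: "real_form 3 (E_cubic a)"
proof -
  define c :: "nat \<Rightarrow> nat \<Rightarrow> nat \<Rightarrow> real" where
    "c = (\<lambda>i j k. if i = 1 \<and> j = 1 \<and> k = 1 then a + 3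
                  else if i = 3 \<or> j = 3 \<or> k = 3 then 0 else 1)"
  have S: "{(i, j, k). i + j + k = (3::nat)} =
     {(3,0,0), (0,3,0), (0,0,3), (2,1,0), (2,0,1), (1,2,0), (0,2,1), (1,0,2), (0,1,2), (1,1,1)}"
    (is "?A = ?B")
  proof
    show "?A \<subseteq> ?B"
    proof
      fix t
      assume "t \<in> ?A"
      then obtain i j k where t: "t = (i, j, k)" and s: "i + j + k = 3" by blast
      from s show "t \<in> ?B"
        unfolding t insert_iff empty_iff prod.inject by presburger
    qed
  qed auto
  show ?thesis
    unfolding real_form_def S
    by (rule exI[of _ c])
       (simp add: c_def E_cubic_def Let_def ring_distribs power2_eq_square mult_ac)
qed

lemma partial_E_cubic:
  fixes v :: "complex ^ 3"
  defines "x \<equiv> v $ 1" and "y \<equiv> v $ 2" and "z \<equiv> v $ 3"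
  shows "partial (E_cubic a) 1 v = 2 * x * (y + z) + y\<^sup>2 + z\<^sup>2 + (of_real a + 3) * y * z"
    and "partial (E_cubic a) 2 v = 2 * y * (x + z) + x\<^sup>2 + z\<^sup>2 + (of_real a + 3) * x * z"
    and "partial (E_cubic a) 3 v = 2 * z * (x + y) + x\<^sup>2 + y\<^sup>2 + (of_real a + 3) * x * y"
  unfolding partial_def E_cubic_def Let_def x_def y_def z_def
  by (rule DERIV_imp_deriv,
      auto intro!: derivative_eq_intros simp: algebra_simps power2_eq_square)+

lemma elliptic_curve_E_cubic:
  assumes "a \<notin> {0, -1, -9}"
  shows "elliptic_curve (E_cubic a) E_base"
proof -
  define b :: complex where "b = of_real a"
  have b: "b \<noteq> 0" "b + 1 \<noteq> 0" "b + 9 \<noteq> 0"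
  proof -
    have "b + 1 = of_real (a + 1)" "b + 9 = of_real (a + 9)" by (simp_all add: b_def)
    with assms show "b \<noteq> 0" "b + 1 \<noteq> 0" "b + 9 \<noteq> 0"
      by (simp_all add: b_def del: of_real_add)
  qed
  have two: "x = 0 \<and> z = 0"
    if 1: "2 * x * (x + z) + x\<^sup>2 + z\<^sup>2 + (b + 3) * x * z = 0"
      and 3: "2 * z * (x + x) + x\<^sup>2 + x\<^sup>2 + (b + 3) * x * x = 0" for x z :: complex
  proof -
    have e: "x * ((b + 5) * x + 4 * z) = 0"
      using 3 by (simp add: algebra_simps power2_eq_square)
    show ?thesis
    proof (cases "x = 0")
      case True
      with 1 show ?thesis by simp
    next
      case False
      with e have "(b + 5) * x + 4 * z = 0" by simp
      then have z: "4 * z = - (b + 5) * x" by algebra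
      have "0 = 16 * (2 * x * (x + z) + x\<^sup>2 + z\<^sup>2 + (b + 3) * x * z)" using 1 by simp
      also have "\<dots> = 48 * x\<^sup>2 + 4 * (b + 5) * x * (4 * z) + (4 * z)\<^sup>2"
        by (simp add: algebra_simps power2_eq_square)
      also have "\<dots> = - 3 * (b + 1) * (b + 9) * x\<^sup>2"
        unfolding z by (simp add: algebra_simps power2_eq_square)
      finally have "(b + 1) * ((b + 9) * x\<^sup>2) = 0" by algebra
      then show ?thesis using b False by simp
    qed
  qed
  have "v = 0" if p: "\<And>i. partial (E_cubic a) i v = 0" for v :: "complex ^ 3"
  proof -
    define x y z where xyz: "x = v $ 1" "y = v $ 2" "z = v $ 3"
    have 1: "2 * x * (y + z) + y\<^sup>2 + z\<^sup>2 + (b + 3) * y * z = 0"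
      and 2: "2 * y * (x + z) + x\<^sup>2 + z\<^sup>2 + (b + 3) * x * z = 0"
      and 3: "2 * z * (x + y) + x\<^sup>2 + y\<^sup>2 + (b + 3) * x * y = 0"
      using p[of 1] p[of 2] p[of 3] by (simp_all add: partial_E_cubic xyz b_def)
    have 12: "(y - x) * (x + y + (b + 1) * z) = 0" using 1 2 by algebra
    have 23: "(z - y) * (y + z + (b + 1) * x) = 0" using 2 3 by algebra
    have "x = 0 \<and> y = 0 \<and> z = 0"
    proof (cases "x = y \<or> y = z \<or> x = z")
      case True
      then consider "x = y" | "y = z" | "x = z" by blast
      then show ?thesis
      proof cases
        case 1
        then show ?thesis using two[of x z] \<open>2 * x * (y + z) + _ + _ + _ = 0\<close> 3
          by (simp add: algebra_simps)
      next
        case 2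
        then show ?thesis using two[of y x] 1 3 by (simp add: algebra_simps)
      next
        case 3
        then show ?thesis using two[of x y] 1 2 by (simp add: algebra_simps)
      qed
    next
      case False
      then have "x + y + (b + 1) * z = 0" "y + z + (b + 1) * x = 0" using 12 23 by auto
      then have "b * (z - x) = 0" by algebra
      with b False show ?thesis by simp
    qed
    then show ?thesis by (simp add: xyz vec_eq_iff forall_3)
  qed
  then have "nonsingular (E_cubic a)" unfolding nonsingular_def by blast
  moreover have "E_base \<noteq> 0" by (simp add: E_base_def vec_eq_iff forall_3)
  moreover have "E_cubic a (of_real_vec E_base) = 0"
    by (simp add: E_cubic_def E_base_def of_real_vec_def Let_def)
  ultimately show ?thesis by (simp add: elliptic_curve_def real_form_E_cubic)
qed

end

theory Submission
  imports Defs
begin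

text \<open>
  If the base point is a flex, a linear change of coordinates takes the curve to a Weierstrass
  cubic. Otherwise, choosing the tangent at the base point and the tangent at its third
  intersection with the curve as coordinate lines leads to Nagell's form
  \<open>x y\<^sup>2 + a x y z + b y z\<^sup>2 = c x\<^sup>2 z + d x z\<^sup>2 + e z\<^sup>3\<close>, and \<open>(x z : x y : z\<^sup>2)\<close> extends to an
  isomorphism onto a Weierstrass cubic. Completing the square gives \<open>Y\<^sup>2 = f(X)\<close> with \<open>f\<close> a real
  cubic without multiple real roots. A real root of \<open>f\<close> and a real point of order \<open>3\<close> provide a
  real point of order \<open>6\<close>, and the curves with such a point are the
  \<open>Y\<^sup>2 = X\<^sup>3 + (a\<^sup>2 + 6 a - 3) / 4 X\<^sup>2 - a X\<close>, which are linearly equivalent to \<open>E\<^sub>a\<close>.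
\<close>

section \<open>Real forms\<close>

text \<open>The point (0, 1, -1) is a flex of every E_a, and linear maps preserve flexes. A curve
  whose base point is not a flex therefore needs a nonlinear isomorphism, and the triple of forms
  found for it vanishes at some points of the curve; this is why morphisms are assembled from
  several triples. The parameter comes from 3-torsion. In Y^2 = X^3 + B X^2 + C X scale the abscissa
  of a point of order 3 to 1. The 3-division polynomial then gives 3 + 4 B + 6 C - C^2 = 0, so C =
  -a forces B = (a^2 + 6 a - 3) / 4. At X = 1 the right-hand side is ((a + 1) / 2)^2, so the
  ordinate is automatically real once the root used for scaling is positive. The excluded values are
  those with a multiple root: a = 0 gives a double root at 0, and X^2 + B X + C has discriminant (a
  + 1)^3 (a + 9) / 16.\<close>

lemma finite_exponents [simp]: "finite {(i, j, k). i + j + k = (d::nat)}"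
  by (rule finite_subset[of _ "{..d} \<times> {..d} \<times> {..d}"]) auto

lemma real_form_monomial:
  "real_form (i + j + k) (\<lambda>v. of_real r * (v $ 1) ^ i * (v $ 2) ^ j * (v $ 3) ^ k)"
  unfolding real_form_def
proof (intro exI allI)
  fix v :: "complex ^ 3"
  let ?S = "{(i', j', k'). i' + j' + k' = i + j + k}"
  let ?c = "\<lambda>i' j' k'. if (i', j', k') = (i, j, k) then r else 0"
  have "(\<Sum>(i', j', k') \<in> ?S. of_real (?c i' j' k') * (v $ 1) ^ i' * (v $ 2) ^ j' * (v $ 3) ^ k')
      = (\<Sum>s \<in> ?S. if s = (i, j, k) then of_real r * (v $ 1) ^ i * (v $ 2) ^ j * (v $ 3) ^ k else 0)"
    by (rule sum.cong) (auto split: if_splits)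
  then show "of_real r * (v $ 1) ^ i * (v $ 2) ^ j * (v $ 3) ^ k =
      (\<Sum>(i', j', k') \<in> ?S. of_real (?c i' j' k') * (v $ 1) ^ i' * (v $ 2) ^ j' * (v $ 3) ^ k')"
    by simp
qed

lemma real_form_0: "real_form d (\<lambda>v. 0)"
  unfolding real_form_def by (rule exI[of _ "\<lambda>i j k. 0"]) (simp add: case_prod_unfold)

lemma real_form_add:
  assumes "real_form d F" "real_form d G"
  shows "real_form d (\<lambda>v. F v + G v)"
proof -
  obtain c c' where
    "\<forall>v. F v = (\<Sum>(i, j, k) \<in> {(i, j, k). i + j + k = d}.
        of_real (c i j k) * (v $ 1) ^ i * (v $ 2) ^ j * (v $ 3) ^ k)"
    "\<forall>v. G v = (\<Sum>(i, j, k) \<in> {(i, j, k). i + j + k = d}.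
        of_real (c' i j k) * (v $ 1) ^ i * (v $ 2) ^ j * (v $ 3) ^ k)"
    using assms unfolding real_form_def by blast
  then show ?thesis
    unfolding real_form_def
    by (intro exI[of _ "\<lambda>i j k. c i j k + c' i j k"])
       (simp add: sum.distrib[symmetric] case_prod_unfold ring_distribs)
qed

lemma real_form_sum:
  "(\<And>s. s \<in> S \<Longrightarrow> real_form d (F s)) \<Longrightarrow> real_form d (\<lambda>v. \<Sum>s\<in>S. F s v)"
  by (induction S rule: infinite_finite_induct) (auto intro: real_form_0 real_form_add)

lemma real_form_mult:
  assumes "real_form d F" "real_form e G"
  shows "real_form (d + e) (\<lambda>v. F v * G v)"
proof -
  let ?S = "\<lambda>d. {(i, j, k). i + j + k = (d::nat)}"
  obtain c c' where
    F: "\<forall>v. F v = (\<Sum>(i, j, k) \<in> ?S d. of_real (c i j k) * (v $ 1) ^ i * (v $ 2) ^ j * (v $ 3) ^ k)" and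
    G: "\<forall>v. G v = (\<Sum>(i, j, k) \<in> ?S e. of_real (c' i j k) * (v $ 1) ^ i * (v $ 2) ^ j * (v $ 3) ^ k)"
    using assms unfolding real_form_def by blast
  have FG: "(\<lambda>v. F v * G v) = (\<lambda>v. \<Sum>s\<in>?S d. \<Sum>t\<in>?S e.
      (case s of (i, j, k) \<Rightarrow> case t of (i', j', k') \<Rightarrow>
        of_real (c i j k * c' i' j' k') * (v $ 1) ^ (i + i') * (v $ 2) ^ (j + j') * (v $ 3) ^ (k + k')))"
    unfolding F[rule_format] G[rule_format] sum_product case_prod_unfold
    by (intro ext sum.cong refl) (simp add: power_add mult_ac)
  show ?thesis
    unfolding FG
  proof (intro real_form_sum)
    fix s t assume "s \<in> ?S d" "t \<in> ?S e"
    then obtain i j k i' j' k' where "s = (i, j, k)" "t = (i', j', k')"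
      "d + e = (i + i') + (j + j') + (k + k')"
      by auto
    then show "real_form (d + e) (\<lambda>v. case s of (i, j, k) \<Rightarrow> case t of (i', j', k') \<Rightarrow>
        of_real (c i j k * c' i' j' k') * (v $ 1) ^ (i + i') * (v $ 2) ^ (j + j') * (v $ 3) ^ (k + k'))"
      using real_form_monomial[of "i + i'" "j + j'" "k + k'" "c i j k * c' i' j' k'"] by simp
  qed
qed

lemma real_form_const: "real_form 0 (\<lambda>v. of_real r)"
  using real_form_monomial[of 0 0 0 r] by simp

lemma real_form_scale: "real_form d F \<Longrightarrow> real_form d (\<lambda>v. of_real r * F v)"
  using real_form_mult[OF real_form_const, of d F r] by simp

lemma real_form_nth: "real_form 1 (\<lambda>v. v $ i)"
  using real_form_monomial[of 1 0 0 1] real_form_monomial[of 0 1 0 1] real_form_monomial[of 0 0 1 1]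
    exhaust_3[of i] by auto

lemma real_form_power: "real_form d F \<Longrightarrow> real_form (n * d) (\<lambda>v. F v ^ n)"
  by (induction n) (use real_form_const[of 1] real_form_mult in auto)

lemma real_form_compose:
  assumes "real_form d F" "\<And>i. real_form e (\<lambda>v. h v $ i)"
  shows "real_form (d * e) (\<lambda>v. F (h v))"
proof -
  let ?S = "{(i, j, k). i + j + k = d}"
  obtain c where
    F: "\<forall>v. F v = (\<Sum>(i, j, k) \<in> ?S. of_real (c i j k) * (v $ 1) ^ i * (v $ 2) ^ j * (v $ 3) ^ k)"
    using assms unfolding real_form_def by blast
  show ?thesis
    unfolding F[rule_format]
  proof (intro real_form_sum)
    fix s assume "s \<in> ?S"
    then obtain i j k where s: "s = (i, j, k)" "d * e = 0 + i * e + j * e + k * e"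
      by (auto simp: algebra_simps)
    show "real_form (d * e) (\<lambda>v. case s of (i, j, k) \<Rightarrow>
        of_real (c i j k) * (h v $ 1) ^ i * (h v $ 2) ^ j * (h v $ 3) ^ k)"
      unfolding s prod.case
      by (intro real_form_mult real_form_power assms(2) real_form_const)
  qed
qed

lemma real_form_homogeneous:
  assumes "real_form d F"
  shows "F (k *s v) = k ^ d * F v"
proof -
  obtain c where
    F: "\<forall>v. F v = (\<Sum>(i, j, l) \<in> {(i, j, l). i + j + l = d}.
      of_real (c i j l) * (v $ 1) ^ i * (v $ 2) ^ j * (v $ 3) ^ l)"
    using assms unfolding real_form_def by blast
  show ?thesis
    unfolding F[rule_format] sum_distrib_left
    by (rule sum.cong) (auto simp: power_mult_distrib power_add)
qed

text \<open>\<open>partial\<close> is a \<open>deriv\<close> in one variable at a time. Comparison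
  with the formal derivatives of a polynomial yields a chain rule for linear substitutions, on which
  the transfer of nonsingularity and the tangent line depend.\<close>

lemma directional_derivative:
  fixes v w :: "complex ^ 3"
  assumes "real_form d F"
  shows "((\<lambda>t. F (v + t *s w)) has_field_derivative
           (w $ 1 * partial F 1 v + w $ 2 * partial F 2 v + w $ 3 * partial F 3 v)) (at 0)"
proof -
  obtain c where
    F: "\<forall>v. F v = (\<Sum>(i, j, k) \<in> {(i, j, k). i + j + k = d}.
      of_real (c i j k) * (v $ 1) ^ i * (v $ 2) ^ j * (v $ 3) ^ k)"
    using assms unfolding real_form_def by blast
  define S where "S = {(i, j, k). i + j + k = d}"
  \<comment> \<open>The formal partial derivatives. At exponent 0 the truncated \<open>i - 1\<close>
    does no harm, because the factor \<open>of_nat i\<close> is 0.\<close>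
  define P where "P = (\<lambda>l::3. \<Sum>(i, j, k) \<in> S. of_real (c i j k) *
    (if l = 1 then of_nat i * (v $ 1) ^ (i - 1) * (v $ 2) ^ j * (v $ 3) ^ k
     else if l = 2 then (v $ 1) ^ i * of_nat j * (v $ 2) ^ (j - 1) * (v $ 3) ^ k
     else (v $ 1) ^ i * (v $ 2) ^ j * of_nat k * (v $ 3) ^ (k - 1)))"
  have D: "((\<lambda>t. F (v + t *s w)) has_field_derivative (w $ 1 * P 1 + w $ 2 * P 2 + w $ 3 * P 3)) (at 0)"
    for w
  proof -
    have "((\<lambda>t. \<Sum>(i, j, k) \<in> S. of_real (c i j k) *
             (v $ 1 + t * w $ 1) ^ i * (v $ 2 + t * w $ 2) ^ j * (v $ 3 + t * w $ 3) ^ k)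
        has_field_derivative (\<Sum>s\<in>S. case s of (i, j, k) \<Rightarrow> of_real (c i j k) *
         (w $ 1 * (of_nat i * (v $ 1) ^ (i - 1) * (v $ 2) ^ j * (v $ 3) ^ k)
          + w $ 2 * ((v $ 1) ^ i * of_nat j * (v $ 2) ^ (j - 1) * (v $ 3) ^ k)
          + w $ 3 * ((v $ 1) ^ i * (v $ 2) ^ j * of_nat k * (v $ 3) ^ (k - 1))))) (at 0)"
      unfolding case_prod_unfold
      by (rule DERIV_sum) (auto intro!: derivative_eq_intros simp: algebra_simps)
    moreover have "(\<Sum>s\<in>S. case s of (i, j, k) \<Rightarrow> of_real (c i j k) *
         (w $ 1 * (of_nat i * (v $ 1) ^ (i - 1) * (v $ 2) ^ j * (v $ 3) ^ k)
          + w $ 2 * ((v $ 1) ^ i * of_nat j * (v $ 2) ^ (j - 1) * (v $ 3) ^ k)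
          + w $ 3 * ((v $ 1) ^ i * (v $ 2) ^ j * of_nat k * (v $ 3) ^ (k - 1))))
      = w $ 1 * P 1 + w $ 2 * P 2 + w $ 3 * P 3"
      unfolding P_def sum_distrib_left sum.distrib[symmetric]
      by (rule sum.cong) (auto simp: algebra_simps)
    ultimately show ?thesis by (simp add: F S_def)
  qed
  have "partial F i v = P i" for i
  proof -
    have "(\<chi> j. if j = i then t else v $ j) = v + (t - v $ i) *s axis i 1" for t
      by (simp add: vec_eq_iff axis_def)
    then have "partial F i v = deriv (\<lambda>t. F (v + (t - v $ i) *s axis i 1)) (v $ i)"
      by (simp add: partial_def)
    moreover have "((\<lambda>t. F (v + (t - v $ i) *s axis i 1)) has_field_derivative P i) (at (v $ i))"
    proof -
      have "((\<lambda>t. F (v + t *s axis i 1)) has_field_derivative P i) (at (v $ i - v $ i))"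
        using D[of "axis i 1"] exhaust_3[of i] by (auto simp: axis_def)
      then show ?thesis
        by (rule DERIV_chain2[THEN DERIV_cong]) (auto intro!: derivative_eq_intros)
    qed
    ultimately show ?thesis by (simp add: DERIV_imp_deriv)
  qed
  then show ?thesis using D[of w] by simp
qed

section \<open>Morphisms given by compatible triples of forms\<close>

lemma ppoint_scale:
  assumes "k \<noteq> 0"
  shows "ppoint (k *s v) = ppoint v"
proof -
  have "l *s v = (l / k) *s (k *s v)" "l *s (k *s v) = (l * k) *s v" for l
    using assms by (simp_all add: vector_smult_assoc)
  then show ?thesis
    unfolding ppoint_def using assms by (metis (no_types, lifting) divide_eq_0_iff mult_eq_0_iff)
qed

lemma ppoint_eqD:
  assumes "ppoint u = ppoint v"
  obtains k where "k \<noteq> 0" "u = k *s v"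
proof -
  have "u \<in> ppoint u" unfolding ppoint_def by (auto intro!: exI[of _ 1])
  then show ?thesis using assms that unfolding ppoint_def by auto
qed

lemma ppoint_eqI:
  fixes u v :: "complex ^ 3"
  assumes "u \<noteq> 0" "v \<noteq> 0"
    and "u $ 1 * v $ 2 = u $ 2 * v $ 1" "u $ 1 * v $ 3 = u $ 3 * v $ 1" "u $ 2 * v $ 3 = u $ 3 * v $ 2"
  shows "ppoint u = ppoint v"
proof -
  have c: "u $ i * v $ j = u $ j * v $ i" for i j
    using exhaust_3[of i] exhaust_3[of j] assms(3-5) by auto
  obtain j where j: "v $ j \<noteq> 0" using assms(2) by (auto simp: vec_eq_iff)
  have "u = (u $ j / v $ j) *s v"
    using j c[of _ j] by (simp add: vec_eq_iff field_simps)
  moreover from this have "u $ j / v $ j \<noteq> 0" using assms(1) by auto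
  ultimately show ?thesis using ppoint_scale by metis
qed

lemma curve_points_iff:
  assumes "real_form d F"
  shows "ppoint v \<in> curve_points F \<longleftrightarrow> v \<noteq> 0 \<and> F v = 0"
proof
  assume "ppoint v \<in> curve_points F"
  then obtain w where w: "ppoint v = ppoint w" "w \<noteq> 0" "F w = 0" unfolding curve_points_def by auto
  then obtain k where "k \<noteq> 0" "v = k *s w" using ppoint_eqD by metis
  then show "v \<noteq> 0 \<and> F v = 0" using w real_form_homogeneous[OF assms] by simp
qed (auto simp: curve_points_def)

definition form_map :: "nat \<Rightarrow> (complex ^ 3 \<Rightarrow> complex ^ 3) \<Rightarrow> bool" where
  "form_map d h \<longleftrightarrow> (\<forall>i. real_form d (\<lambda>v. h v $ i))"

lemma form_map_homogeneous: "form_map d h \<Longrightarrow> h (k *s v) = k ^ d *s h v"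
  using real_form_homogeneous[of d "\<lambda>v. h v $ _"] by (simp add: form_map_def vec_eq_iff)

lemma real_morphismI:
  assumes "\<phi> ` curve_points F \<subseteq> curve_points G"
    and "\<And>u. u \<noteq> 0 \<Longrightarrow> F u = 0 \<Longrightarrow> \<exists>d h. form_map d h \<and> h u \<noteq> 0 \<and>
      (\<forall>v. v \<noteq> 0 \<longrightarrow> F v = 0 \<longrightarrow> h v \<noteq> 0 \<longrightarrow> \<phi> (ppoint v) = ppoint (h v))"
  shows "real_morphism F G \<phi>"
  unfolding real_morphism_def
proof (intro conjI allI impI)
  fix u assume "u \<noteq> 0 \<and> F u = 0"
  then obtain d h where "form_map d h" "h u \<noteq> 0"
    "\<forall>v. v \<noteq> 0 \<longrightarrow> F v = 0 \<longrightarrow> h v \<noteq> 0 \<longrightarrow> \<phi> (ppoint v) = ppoint (h v)"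
    using assms(2) by metis
  then show "\<exists>d H. (\<forall>i. real_form d (H i)) \<and> (\<chi> i. H i u) \<noteq> 0 \<and>
      (\<forall>v. v \<noteq> 0 \<and> F v = 0 \<and> (\<chi> i. H i v) \<noteq> 0 \<longrightarrow> \<phi> (ppoint v) = ppoint (\<chi> i. H i v))"
    by (intro exI[of _ d] exI[of _ "\<lambda>i v. h v $ i"]) (simp add: form_map_def)
qed (use assms(1) in simp)

lemma real_morphism_image: "real_morphism F G \<phi> \<Longrightarrow> \<phi> ` curve_points F \<subseteq> curve_points G"
  by (simp add: real_morphism_def)

lemma real_morphismE:
  assumes "real_morphism F G \<phi>" "u \<noteq> 0" "F u = 0"
  obtains d h where "form_map d h" "h u \<noteq> 0"
    "\<And>v. v \<noteq> 0 \<Longrightarrow> F v = 0 \<Longrightarrow> h v \<noteq> 0 \<Longrightarrow> \<phi> (ppoint v) = ppoint (h v)"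
proof -
  have "\<exists>d H. (\<forall>i. real_form d (H i)) \<and> (\<chi> i. H i u) \<noteq> 0 \<and>
      (\<forall>v. v \<noteq> 0 \<and> F v = 0 \<and> (\<chi> i. H i v) \<noteq> 0 \<longrightarrow> \<phi> (ppoint v) = ppoint (\<chi> i. H i v))"
    using assms unfolding real_morphism_def by simp
  then obtain d H where "\<forall>i. real_form d (H i)" "(\<chi> i. H i u) \<noteq> 0"
    "\<forall>v. v \<noteq> 0 \<and> F v = 0 \<and> (\<chi> i. H i v) \<noteq> 0 \<longrightarrow> \<phi> (ppoint v) = ppoint (\<chi> i. H i v)"
    by (elim exE conjE)
  then show ?thesis using that[of d "\<lambda>v. \<chi> i. H i v"] by (simp add: form_map_def)
qed

text \<open>\<open>G (h u) = 0\<close> is asked even where \<open>h u\<close> vanishes: it is a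
  polynomial identity modulo the equation of the curve, so it can be checked without case
  distinctions.\<close>

definition atlas ::
  "(complex ^ 3 \<Rightarrow> complex) \<Rightarrow> (complex ^ 3 \<Rightarrow> complex) \<Rightarrow> (complex ^ 3 \<Rightarrow> complex ^ 3) set \<Rightarrow> bool"
where
  "atlas F G \<H> \<longleftrightarrow>
     (\<forall>h\<in>\<H>. \<exists>d. form_map d h) \<and>
     (\<forall>u. u \<noteq> 0 \<and> F u = 0 \<longrightarrow>
        (\<exists>h\<in>\<H>. h u \<noteq> 0) \<and>
        (\<forall>h\<in>\<H>. G (h u) = 0) \<and>
        (\<forall>h\<in>\<H>. \<forall>h'\<in>\<H>. h u \<noteq> 0 \<longrightarrow> h' u \<noteq> 0 \<longrightarrow> ppoint (h u) = ppoint (h' u)))"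

lemma real_morphism_of_atlas:
  assumes "atlas F G \<H>" "real_form m F"
  obtains \<phi> where "real_morphism F G \<phi>"
    "\<And>h u. h \<in> \<H> \<Longrightarrow> u \<noteq> 0 \<Longrightarrow> F u = 0 \<Longrightarrow> h u \<noteq> 0 \<Longrightarrow> \<phi> (ppoint u) = ppoint (h u)"
proof -
  have forms: "\<And>h. h \<in> \<H> \<Longrightarrow> \<exists>d. form_map d h"
    and cover: "\<And>u. u \<noteq> 0 \<Longrightarrow> F u = 0 \<Longrightarrow> \<exists>h\<in>\<H>. h u \<noteq> 0"
    and into: "\<And>h u. h \<in> \<H> \<Longrightarrow> u \<noteq> 0 \<Longrightarrow> F u = 0 \<Longrightarrow> G (h u) = 0"
    and compat: "\<And>h h' u. h \<in> \<H> \<Longrightarrow> h' \<in> \<H> \<Longrightarrow> u \<noteq> 0 \<Longrightarrow> F u = 0 \<Longrightarrow> h u \<noteq> 0 \<Longrightarrow> h' u \<noteq> 0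
      \<Longrightarrow> ppoint (h u) = ppoint (h' u)"
    using assms(1) unfolding atlas_def by blast+
  \<comment> \<open>The value at a point is read off from an arbitrary triple and an arbitrary
    representative. Homogeneity makes it independent of the representative, compatibility of the
    triple.\<close>
  define R where "R = (\<lambda>P (h, u). h \<in> \<H> \<and> u \<noteq> 0 \<and> F u = 0 \<and> h u \<noteq> 0 \<and> P = ppoint u)"
  define \<phi> where "\<phi> = (\<lambda>P. case (SOME hu. R P hu) of (h, u) \<Rightarrow> ppoint (h u))"
  have \<phi>: "\<phi> (ppoint u) = ppoint (h u)" if h: "h \<in> \<H>" "u \<noteq> 0" "F u = 0" "h u \<noteq> 0" for h u
  proof -
    obtain h' u' where e: "(SOME hu. R (ppoint u) hu) = (h', u')" by fastforce
    have "R (ppoint u) (h, u)" using h by (simp add: R_def)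
    then have "R (ppoint u) (h', u')" unfolding e[symmetric] by (rule someI)
    then have h': "h' \<in> \<H>" "h' u' \<noteq> 0" "ppoint u = ppoint u'" by (auto simp: R_def)
    obtain k where k: "k \<noteq> 0" "u' = k *s u" using ppoint_eqD h'(3) by metis
    obtain d where "form_map d h'" using forms h' by blast
    then have hk: "h' u' = k ^ d *s h' u" using k form_map_homogeneous by metis
    then have "h' u \<noteq> 0" using h' by auto
    then have "ppoint (h u) = ppoint (h' u)" using compat h h' by blast
    also have "\<dots> = ppoint (h' u')" using hk k ppoint_scale by simp
    finally show ?thesis by (simp add: \<phi>_def e)
  qed
  have "real_morphism F G \<phi>"
  proof (rule real_morphismI)
    show "\<phi> ` curve_points F \<subseteq> curve_points G"
    proof
      fix Q assume "Q \<in> \<phi> ` curve_points F"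
      then obtain u where u: "u \<noteq> 0" "F u = 0" "Q = \<phi> (ppoint u)" unfolding curve_points_def by auto
      obtain h where "h \<in> \<H>" "h u \<noteq> 0" using cover u by blast
      then show "Q \<in> curve_points G"
        using u \<phi> into unfolding curve_points_def by blast
    qed
  qed (use cover forms \<phi> in metis)
  with \<phi> that show ?thesis by blast
qed

text \<open>Both atlases cover their curves, so every point has a pair of triples whose composite is
  defined there; testing inverses on such pairs, and the base point in one triple, is
  enough.\<close>

lemma isomorphic_of_atlas:
  assumes "real_form m F" "real_form n G" "atlas F G \<H>" "atlas G F \<K>"
    and inv: "\<And>h k u. h \<in> \<H> \<Longrightarrow> k \<in> \<K> \<Longrightarrow> u \<noteq> 0 \<Longrightarrow> F u = 0 \<Longrightarrow> h u \<noteq> 0 \<Longrightarrow> k (h u) \<noteq> 0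
        \<Longrightarrow> ppoint (k (h u)) = ppoint u"
    and inv': "\<And>h k u. h \<in> \<H> \<Longrightarrow> k \<in> \<K> \<Longrightarrow> u \<noteq> 0 \<Longrightarrow> G u = 0 \<Longrightarrow> k u \<noteq> 0 \<Longrightarrow> h (k u) \<noteq> 0
        \<Longrightarrow> ppoint (h (k u)) = ppoint u"
    and p: "p \<noteq> 0" "F (of_real_vec p) = 0"
    and q: "h\<^sub>0 \<in> \<H>" "h\<^sub>0 (of_real_vec p) = c *s of_real_vec q" "c \<noteq> 0" "q \<noteq> 0"
  shows "isomorphic_over_reals F p G q"
proof -
  obtain \<phi> where \<phi>: "real_morphism F G \<phi>"
    "\<And>h u. h \<in> \<H> \<Longrightarrow> u \<noteq> 0 \<Longrightarrow> F u = 0 \<Longrightarrow> h u \<noteq> 0 \<Longrightarrow> \<phi> (ppoint u) = ppoint (h u)"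
    using real_morphism_of_atlas[OF assms(3,1)] by blast
  obtain \<psi> where \<psi>: "real_morphism G F \<psi>"
    "\<And>h u. h \<in> \<K> \<Longrightarrow> u \<noteq> 0 \<Longrightarrow> G u = 0 \<Longrightarrow> h u \<noteq> 0 \<Longrightarrow> \<psi> (ppoint u) = ppoint (h u)"
    using real_morphism_of_atlas[OF assms(4,2)] by blast
  have nz: "of_real_vec r \<noteq> 0" if "r \<noteq> 0" for r
    using that by (auto simp: of_real_vec_def vec_eq_iff)
  have "\<psi> (\<phi> P) = P" if P: "P \<in> curve_points F" for P
  proof -
    obtain u where u: "u \<noteq> 0" "F u = 0" "P = ppoint u" using P unfolding curve_points_def by blast
    obtain h where h: "h \<in> \<H>" "h u \<noteq> 0" "G (h u) = 0" using assms(3) u unfolding atlas_def by blast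
    obtain k where k: "k \<in> \<K>" "k (h u) \<noteq> 0" using assms(4) h unfolding atlas_def by blast
    show ?thesis using \<phi>(2)[of h u] \<psi>(2)[of k "h u"] inv u h k by simp
  qed
  moreover have "\<phi> (\<psi> P) = P" if P: "P \<in> curve_points G" for P
  proof -
    obtain u where u: "u \<noteq> 0" "G u = 0" "P = ppoint u" using P unfolding curve_points_def by blast
    obtain k where k: "k \<in> \<K>" "k u \<noteq> 0" "F (k u) = 0" using assms(4) u unfolding atlas_def by blast
    obtain h where h: "h \<in> \<H>" "h (k u) \<noteq> 0" using assms(3) k unfolding atlas_def by blast
    show ?thesis using \<psi>(2)[of k u] \<phi>(2)[of h "k u"] inv' u h k by simp
  qed
  moreover have "\<phi> (ppoint (of_real_vec p)) = ppoint (of_real_vec q)"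
    using \<phi>(2)[OF q(1) nz[OF p(1)] p(2)] q nz[OF q(4)] by (simp add: ppoint_scale)
  ultimately show ?thesis using \<phi>(1) \<psi>(1) unfolding isomorphic_over_reals_def by blast
qed

section \<open>Composition of morphisms and transitivity of isomorphism\<close>

lemma real_morphism_compose:
  assumes \<phi>: "real_morphism F G \<phi>" and \<psi>: "real_morphism G K \<psi>" and G: "real_form n G"
  shows "real_morphism F K (\<psi> \<circ> \<phi>)"
proof (rule real_morphismI)
  show "(\<psi> \<circ> \<phi>) ` curve_points F \<subseteq> curve_points K"
    using real_morphism_image[OF \<phi>] real_morphism_image[OF \<psi>] by (auto simp: image_comp[symmetric])
next
  have on_G: "h v \<noteq> 0 \<and> G (h v) = 0" if "v \<noteq> 0" "F v = 0" "\<phi> (ppoint v) = ppoint (h v)" for h v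
  proof -
    have "ppoint v \<in> curve_points F" using that by (auto simp: curve_points_def)
    then have "ppoint (h v) \<in> curve_points G"
      using that(3) real_morphism_image[OF \<phi>] by (metis image_subset_iff)
    then show ?thesis using curve_points_iff[OF G] by simp
  qed
  fix u assume u: "u \<noteq> 0" "F u = 0"
  obtain d h where h: "form_map d h" "h u \<noteq> 0"
    "\<And>v. v \<noteq> 0 \<Longrightarrow> F v = 0 \<Longrightarrow> h v \<noteq> 0 \<Longrightarrow> \<phi> (ppoint v) = ppoint (h v)"
    using real_morphismE[OF \<phi> u] by metis
  have w: "G (h u) = 0" using on_G[of u h] h u by blast
  obtain e k where k: "form_map e k" "k (h u) \<noteq> 0"
    "\<And>v. v \<noteq> 0 \<Longrightarrow> G v = 0 \<Longrightarrow> k v \<noteq> 0 \<Longrightarrow> \<psi> (ppoint v) = ppoint (k v)"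
    using real_morphismE[OF \<psi> h(2) w] by metis
  obtain j where j: "h u $ j \<noteq> 0" using h(2) by (metis vec_eq_iff zero_index)
  \<comment> \<open>The factor \<open>h v $ j\<close> makes the composite vanish where \<open>h\<close> does, also if \<open>k\<close> is constant.\<close>
  define l where "l = (\<lambda>v. h v $ j *s k (h v))"
  have hf: "real_form d (\<lambda>v. h v $ i)" for i using h(1) by (simp add: form_map_def)
  have kf: "real_form e (\<lambda>v. k v $ i)" for i using k(1) by (simp add: form_map_def)
  have "form_map (d + e * d) l"
    unfolding form_map_def l_def
    using real_form_mult[OF hf real_form_compose[OF kf hf]] by simp
  moreover have "l u \<noteq> 0" using j k(2) by (simp add: l_def)
  moreover have "(\<psi> \<circ> \<phi>) (ppoint v) = ppoint (l v)" if v: "v \<noteq> 0" "F v = 0" "l v \<noteq> 0" for v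
  proof -
    have v': "h v $ j \<noteq> 0" "k (h v) \<noteq> 0" using v(3) by (auto simp: l_def)
    then have "h v \<noteq> 0" by (metis zero_index)
    then have 1: "\<phi> (ppoint v) = ppoint (h v)" by (rule h(3)[OF v(1,2)])
    have "\<psi> (ppoint (h v)) = ppoint (k (h v))"
      using on_G[of v h] v 1 k(3) v'(2) by blast
    then show ?thesis using 1 v'(1) by (simp add: ppoint_scale l_def)
  qed
  ultimately show "\<exists>d h. form_map d h \<and> h u \<noteq> 0 \<and>
      (\<forall>v. v \<noteq> 0 \<longrightarrow> F v = 0 \<longrightarrow> h v \<noteq> 0 \<longrightarrow> (\<psi> \<circ> \<phi>) (ppoint v) = ppoint (h v))"
    by (intro exI[of _ "d + e * d"] exI[of _ l]) simp
qed

lemma isomorphic_over_reals_trans: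
  assumes "isomorphic_over_reals F p G q" "isomorphic_over_reals G q K r" "real_form n G"
  shows "isomorphic_over_reals F p K r"
proof -
  obtain \<phi> \<psi> where 1: "real_morphism F G \<phi>" "real_morphism G F \<psi>"
    "\<forall>P \<in> curve_points F. \<psi> (\<phi> P) = P" "\<forall>Q \<in> curve_points G. \<phi> (\<psi> Q) = Q"
    "\<phi> (ppoint (of_real_vec p)) = ppoint (of_real_vec q)"
    using assms(1) unfolding isomorphic_over_reals_def by (elim exE conjE)
  obtain \<phi>' \<psi>' where 2: "real_morphism G K \<phi>'" "real_morphism K G \<psi>'"
    "\<forall>P \<in> curve_points G. \<psi>' (\<phi>' P) = P" "\<forall>Q \<in> curve_points K. \<phi>' (\<psi>' Q) = Q"
    "\<phi>' (ppoint (of_real_vec q)) = ppoint (of_real_vec r)"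
    using assms(2) unfolding isomorphic_over_reals_def by (elim exE conjE)
  have "\<phi> P \<in> curve_points G" if "P \<in> curve_points F" for P
    using real_morphism_image[OF 1(1)] that by blast
  moreover have "\<psi>' Q \<in> curve_points G" if "Q \<in> curve_points K" for Q
    using real_morphism_image[OF 2(2)] that by blast
  ultimately show ?thesis
    unfolding isomorphic_over_reals_def
    using real_morphism_compose[OF 1(1) 2(1) assms(3)] real_morphism_compose[OF 2(2) 1(2) assms(3)]
      1(3-5) 2(3-5)
    by (intro exI[of _ "\<phi>' \<circ> \<phi>"] exI[of _ "\<psi> \<circ> \<psi>'"]) simp
qed

section \<open>Linear changes of coordinates\<close>

definition cmat :: "real ^ 3 ^ 3 \<Rightarrow> complex ^ 3 ^ 3" where
  "cmat A = (\<chi> i j. of_real (A $ i $ j))"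

lemma cmat_mult: "cmat A ** cmat B = cmat (A ** B)"
  by (simp add: cmat_def matrix_matrix_mult_def vec_eq_iff)

lemma cmat_mult_of_real_vec: "cmat A *v of_real_vec p = of_real_vec (A *v p)"
  by (simp add: cmat_def of_real_vec_def matrix_vector_mult_def vec_eq_iff)

lemma cmat_inverse:
  assumes "A ** B = mat 1"
  shows "cmat A *v (cmat B *v v) = v"
proof -
  have "cmat (mat 1) = mat 1" by (simp add: cmat_def mat_def vec_eq_iff)
  then show ?thesis by (simp add: matrix_vector_mul_assoc cmat_mult assms)
qed

lemma form_map_cmat: "form_map 1 (\<lambda>v. cmat A *v v)"
  unfolding form_map_def matrix_vector_mult_def cmat_def
  using real_form_sum[of UNIV 1 "\<lambda>j v. of_real (A $ _ $ j) * v $ j"]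
    real_form_scale[OF real_form_nth] by simp

lemma real_form_linear: "real_form d F \<Longrightarrow> real_form d (\<lambda>v. F (cmat A *v v))"
  using real_form_compose[of d F 1 "\<lambda>v. cmat A *v v"] form_map_cmat by (simp add: form_map_def)

lemma isomorphic_linear:
  assumes G: "real_form n G" and A: "det A \<noteq> 0" and k: "k \<noteq> 0"
    and F: "\<And>v. F v = of_real k * G (cmat A *v v)"
    and p: "p \<noteq> 0" "F (of_real_vec p) = 0" and q: "A *v p = c *s q" "c \<noteq> 0"
  shows "isomorphic_over_reals F p G q"
proof -
  obtain B where AB: "A ** B = mat 1" "B ** A = mat 1"
    using A invertible_det_nz[of A] by (auto simp: invertible_def)
  have nz: "cmat A *v v \<noteq> 0" "cmat B *v v \<noteq> 0" if "v \<noteq> 0" for v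
    using cmat_inverse[OF AB(1), of v] cmat_inverse[OF AB(2), of v] that by auto
  have "A *v p \<noteq> 0"
  proof
    assume "A *v p = 0"
    then have "(B ** A) *v p = 0" by (simp flip: matrix_vector_mul_assoc)
    then show False using AB p by simp
  qed
  then have q0: "q \<noteq> 0" using q by auto
  have fm: "\<exists>d. form_map d (\<lambda>v. cmat M *v v)" for M using form_map_cmat by blast
  have "of_real_vec (c *s q) = of_real c *s of_real_vec q"
    by (simp add: of_real_vec_def vec_eq_iff)
  then have pq: "cmat A *v of_real_vec p = of_real c *s of_real_vec q"
    by (simp add: cmat_mult_of_real_vec q)
  have rf: "real_form n F"
    unfolding F[abs_def] by (intro real_form_scale real_form_linear G)
  have FA: "F v = 0 \<longleftrightarrow> G (cmat A *v v) = 0" for v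
    using k by (simp add: F)
  have "atlas F G {\<lambda>v. cmat A *v v}"
    unfolding atlas_def using nz(1) fm FA by simp
  moreover have "atlas G F {\<lambda>v. cmat B *v v}"
    unfolding atlas_def using nz(2) fm by (simp add: FA cmat_inverse[OF AB(1)])
  ultimately show ?thesis
    using isomorphic_of_atlas[OF rf G, of "{\<lambda>v. cmat A *v v}" "{\<lambda>v. cmat B *v v}" p
        "\<lambda>v. cmat A *v v" "of_real c" q]
      p pq q q0 by (simp add: cmat_inverse[OF AB(1)] cmat_inverse[OF AB(2)])
qed

lemma directional_derivative_linear:
  fixes A :: "real ^ 3 ^ 3" and k :: real
  assumes "real_form d F"
  defines "G \<equiv> \<lambda>v. of_real k * F (cmat A *v v)"
  shows "w $ 1 * partial G 1 v + w $ 2 * partial G 2 v + w $ 3 * partial G 3 v =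
    of_real k * ((cmat A *v w) $ 1 * partial F 1 (cmat A *v v)
      + (cmat A *v w) $ 2 * partial F 2 (cmat A *v v)
      + (cmat A *v w) $ 3 * partial F 3 (cmat A *v v))"
proof -
  let ?D = "(cmat A *v w) $ 1 * partial F 1 (cmat A *v v)
      + (cmat A *v w) $ 2 * partial F 2 (cmat A *v v)
      + (cmat A *v w) $ 3 * partial F 3 (cmat A *v v)"
  have "((\<lambda>t. F (cmat A *v v + t *s (cmat A *v w))) has_field_derivative ?D) (at 0)"
    by (rule directional_derivative[OF assms(1)])
  then have "((\<lambda>t. of_real k * F (cmat A *v v + t *s (cmat A *v w))) has_field_derivative
      of_real k * ?D) (at 0)"
    by (rule DERIV_cmult)
  moreover have "(\<lambda>t. G (v + t *s w)) = (\<lambda>t. of_real k * F (cmat A *v v + t *s (cmat A *v w)))"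
    by (simp add: G_def matrix_vector_right_distrib vector_scalar_commute)
  ultimately have "((\<lambda>t. G (v + t *s w)) has_field_derivative of_real k * ?D) (at 0)"
    by simp
  moreover have "real_form d G"
    unfolding G_def by (intro real_form_scale real_form_linear assms(1))
  ultimately show ?thesis
    using DERIV_unique directional_derivative by blast
qed

text \<open>\<open>A\<close> expresses old coordinates in terms of new ones, hence takes the new
  base point \<open>q\<close> to the old one; the isomorphism itself is given by the inverse
  matrix.\<close>

lemma elliptic_curve_linear:
  fixes A :: "real ^ 3 ^ 3" and k :: real
  assumes E: "elliptic_curve F (A *v q)" and A: "det A \<noteq> 0" and k: "k \<noteq> 0"
  defines "G \<equiv> \<lambda>v. of_real k * F (cmat A *v v)"
  shows "elliptic_curve G q" and "isomorphic_over_reals F (A *v q) G q"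
proof -
  have F: "real_form 3 F" "nonsingular F" "A *v q \<noteq> 0" "F (of_real_vec (A *v q)) = 0"
    using E by (auto simp: elliptic_curve_def)
  obtain B where AB: "A ** B = mat 1" "B ** A = mat 1"
    using A invertible_det_nz[of A] by (auto simp: invertible_def)
  have G: "real_form 3 G"
    unfolding G_def by (intro real_form_scale real_form_linear F)
  have "nonsingular G"
    unfolding nonsingular_def
  proof (intro allI impI)
    fix v assume v: "v \<noteq> 0 \<and> G v = 0"
    then have "cmat A *v v \<noteq> 0" using cmat_inverse[OF AB(2), of v] by auto
    then obtain i where i: "partial F i (cmat A *v v) \<noteq> 0"
      using F(2) v k unfolding nonsingular_def G_def by auto
    \<comment> \<open>The direction \<open>cmat B *v axis i 1\<close> for \<open>G\<close> becomes
      \<open>axis i 1\<close> for \<open>F\<close>. The derivative of \<open>G\<close> along it is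
      \<open>k\<close> times a nonzero partial derivative, so the partial derivatives of
      \<open>G\<close> cannot all vanish.\<close>
    have "(axis i 1 $ 1 * partial F 1 (cmat A *v v) + axis i 1 $ 2 * partial F 2 (cmat A *v v)
        + axis i 1 $ 3 * partial F 3 (cmat A *v v)) = partial F i (cmat A *v v)"
      using exhaust_3[of i] by (auto simp: axis_def)
    then show "\<exists>i. partial G i v \<noteq> 0"
      using directional_derivative_linear[OF F(1), of "cmat B *v axis i 1" k A v] i k
      by (fold G_def) (metis (no_types, lifting) add.right_neutral cmat_inverse[OF AB(1)] mult_eq_0_iff of_real_eq_0_iff)
  qed
  moreover have "q \<noteq> 0" using F(3) by auto
  moreover have "G (of_real_vec q) = 0" using F(4) by (simp add: G_def cmat_mult_of_real_vec)
  ultimately show "elliptic_curve G q" using G by (simp add: elliptic_curve_def)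
  have "B *v (A *v q) = q" by (simp add: matrix_vector_mul_assoc AB)
  moreover have "det B \<noteq> 0" using AB by (metis det_I det_mul mult_zero_right zero_neq_one)
  moreover have "F v = of_real (1 / k) * G (cmat B *v v)" for v
    using k by (simp add: G_def cmat_inverse[OF AB(1)])
  ultimately show "isomorphic_over_reals F (A *v q) G q"
    using isomorphic_linear[OF G, of B "1 / k" F "A *v q" 1 q] F k by simp
qed

section \<open>Ternary cubics by their ten coefficients\<close>

definition cubic ::
  "real \<Rightarrow> real \<Rightarrow> real \<Rightarrow> real \<Rightarrow> real \<Rightarrow> real \<Rightarrow> real \<Rightarrow> real \<Rightarrow> real \<Rightarrow> real \<Rightarrow> complex ^ 3 \<Rightarrow> complex"
where
  "cubic a b c d e f g h i j v = (let x = v $ 1; y = v $ 2; z = v $ 3 in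
     of_real a * x ^ 3 + of_real b * x\<^sup>2 * y + of_real c * x\<^sup>2 * z + of_real d * x * y\<^sup>2
     + of_real e * x * y * z + of_real f * x * z\<^sup>2 + of_real g * y ^ 3 + of_real h * y\<^sup>2 * z
     + of_real i * y * z\<^sup>2 + of_real j * z ^ 3)"

lemma real_form_3_iff: "real_form 3 F \<longleftrightarrow> (\<exists>a b c d e f g h i j. F = cubic a b c d e f g h i j)"
proof -
  have S: "{(i, j, k). i + j + k = (3::nat)} =
     {(3,0,0), (2,1,0), (2,0,1), (1,2,0), (1,1,1), (1,0,2), (0,3,0), (0,2,1), (0,1,2), (0,0,3)}"
    (is "?A = ?B")
  proof
    show "?A \<subseteq> ?B"
    proof
      fix t assume "t \<in> ?A"
      then obtain i j k where t: "t = (i, j, k)" and "i + j + k = 3" by blast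
      then show "t \<in> ?B"
        unfolding t insert_iff empty_iff prod.inject by presburger
    qed
  qed auto
  show ?thesis
  proof
    assume "real_form 3 F"
    then obtain c where c: "\<forall>v. F v = (\<Sum>(i, j, k) \<in> {(i, j, k). i + j + k = 3}.
        of_real (c i j k) * (v $ 1) ^ i * (v $ 2) ^ j * (v $ 3) ^ k)"
      unfolding real_form_def by (elim exE)
    have "F = cubic (c 3 0 0) (c 2 1 0) (c 2 0 1) (c 1 2 0) (c 1 1 1) (c 1 0 2)
        (c 0 3 0) (c 0 2 1) (c 0 1 2) (c 0 0 3)"
      by (rule ext) (simp add: c[unfolded S, rule_format] cubic_def Let_def mult_ac)
    then show "\<exists>a b c d e f g h i j. F = cubic a b c d e f g h i j" by blast
  next
    assume "\<exists>a b c d e f g h i j. F = cubic a b c d e f g h i j"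
    then obtain a b c d e f g h i j where F: "F = cubic a b c d e f g h i j" by blast
    define C where "C = (\<lambda>(p::nat) (q::nat) (r::nat).
       if p = 3 then a else if p = 2 then (if q = 1 then b else c)
       else if p = 1 then (if q = 2 then d else if q = 1 then e else f)
       else if q = 3 then g else if q = 2 then h else if q = 1 then i else j)"
    show "real_form 3 F"
      unfolding real_form_def S F
      by (rule exI[of _ C]) (simp add: C_def cubic_def Let_def)
  qed
qed

lemma real_form_cubic: "real_form 3 (cubic a b c d e f g h i j)"
  using real_form_3_iff by blast

lemma partial_cubic:
  fixes v :: "complex ^ 3"
  defines "x \<equiv> v $ 1" and "y \<equiv> v $ 2" and "z \<equiv> v $ 3"
  shows "partial (cubic a b c d e f g h i j) 1 v = 3 * of_real a * x\<^sup>2 + 2 * of_real b * x * y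
      + 2 * of_real c * x * z + of_real d * y\<^sup>2 + of_real e * y * z + of_real f * z\<^sup>2"
    and "partial (cubic a b c d e f g h i j) 2 v = of_real b * x\<^sup>2 + 2 * of_real d * x * y
      + of_real e * x * z + 3 * of_real g * y\<^sup>2 + 2 * of_real h * y * z + of_real i * z\<^sup>2"
    and "partial (cubic a b c d e f g h i j) 3 v = of_real c * x\<^sup>2 + of_real e * x * y
      + 2 * of_real f * x * z + of_real h * y\<^sup>2 + 2 * of_real i * y * z + 3 * of_real j * z\<^sup>2"
  unfolding partial_def cubic_def Let_def x_def y_def z_def
  by (rule DERIV_imp_deriv,
      auto intro!: derivative_eq_intros simp: algebra_simps power2_eq_square)+

lemma nonsingular_cubicD:
  assumes "nonsingular (cubic a b c d e f g h i j)"
    and "cubic a b c d e f g h i j (vector [x, y, z]) = 0"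
    and "3 * of_real a * x\<^sup>2 + 2 * of_real b * x * y
      + 2 * of_real c * x * z + of_real d * y\<^sup>2 + of_real e * y * z + of_real f * z\<^sup>2 = 0"
    and "of_real b * x\<^sup>2 + 2 * of_real d * x * y
      + of_real e * x * z + 3 * of_real g * y\<^sup>2 + 2 * of_real h * y * z + of_real i * z\<^sup>2 = 0"
    and "of_real c * x\<^sup>2 + of_real e * x * y
      + 2 * of_real f * x * z + of_real h * y\<^sup>2 + 2 * of_real i * y * z + 3 * of_real j * z\<^sup>2 = 0"
  shows "x = 0 \<and> y = 0 \<and> z = 0"
proof (rule ccontr)
  assume "\<not> ?thesis"
  then have nz: "(vector [x, y, z] :: complex ^ 3) \<noteq> 0" by (auto simp: vec_eq_iff forall_3)
  obtain l where "partial (cubic a b c d e f g h i j) l (vector [x, y, z]) \<noteq> 0"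
    using assms(1)[unfolded nonsingular_def, rule_format, OF conjI[OF nz assms(2)]] by (elim exE)
  then show False
    using exhaust_3[of l] assms(3-5) by (auto simp: partial_cubic)
qed

section \<open>From Weierstrass cubics to the family\<close>

lemma real_cubic_root:
  fixes A B C :: real
  obtains r where "r ^ 3 + A * r\<^sup>2 + B * r + C = 0"
proof -
  \<comment> \<open>A Cauchy bound: M^3 is M^2 times 1 + |A| + |B| + |C|, which outweighs the lower
    terms at both M and -M.\<close>
  define M where "M = 1 + \<bar>A\<bar> + \<bar>B\<bar> + \<bar>C\<bar>"
  have M: "M \<ge> 1" by (simp add: M_def)
  then have M2: "M \<le> M\<^sup>2" "1 \<le> M\<^sup>2" by (simp_all add: self_le_power)
  have bound: "\<bar>A * M\<^sup>2\<bar> + \<bar>B * M\<bar> + \<bar>C\<bar> < M ^ 3"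
  proof -
    have "\<bar>A * M\<^sup>2\<bar> \<le> \<bar>A\<bar> * M\<^sup>2" by (simp add: abs_mult)
    moreover have "\<bar>B * M\<bar> \<le> \<bar>B\<bar> * M\<^sup>2" using M M2 by (simp add: abs_mult mult_left_mono)
    moreover have "\<bar>C\<bar> \<le> \<bar>C\<bar> * M\<^sup>2" using mult_left_mono[OF M2(2), of "\<bar>C\<bar>"] by simp
    moreover have "M ^ 3 = M\<^sup>2 + \<bar>A\<bar> * M\<^sup>2 + \<bar>B\<bar> * M\<^sup>2 + \<bar>C\<bar> * M\<^sup>2"
      by (simp add: power3_eq_cube M_def power2_eq_square algebra_simps)
    ultimately show ?thesis using M2(2) by linarith
  qed
  have "\<exists>r. - M \<le> r \<and> r \<le> M \<and> r ^ 3 + A * r\<^sup>2 + B * r + C = 0"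
  proof (rule IVT')
    show "(- M) ^ 3 + A * (- M)\<^sup>2 + B * (- M) + C \<le> 0" "0 \<le> M ^ 3 + A * M\<^sup>2 + B * M + C"
      using bound by (simp_all add: power3_eq_cube)
  qed (use M in \<open>auto intro!: continuous_intros\<close>)
  then show ?thesis using that by blast
qed

text \<open>
  For a root \<open>r\<close> of the cubic, translate it to the origin, giving \<open>t\<^sup>3 + b t\<^sup>2 + c t\<close>. Since the
  \<open>3\<close>-division polynomial \<open>3 t\<^sup>4 + 4 b t\<^sup>3 + 6 c t\<^sup>2 - c\<^sup>2\<close> is negative at the origin, it has a
  positive root \<open>\<tau> = m\<^sup>2\<close>; together with the origin it yields a real point of order \<open>6\<close>.
\<close>

lemma three_torsion_parameter:
  fixes A B C :: real
  assumes nd: "\<And>x. x ^ 3 + A * x\<^sup>2 + B * x + C = 0 \<Longrightarrow> 3 * x\<^sup>2 + 2 * A * x + B \<noteq> 0"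
  obtains r m a where "m \<noteq> 0" "a \<notin> {0, -1, -9}" "r ^ 3 + A * r\<^sup>2 + B * r + C = 0"
    "4 * (3 * r + A) = m\<^sup>2 * (a\<^sup>2 + 6 * a - 3)" "3 * r\<^sup>2 + 2 * A * r + B = - a * m ^ 4"
proof -
  obtain r where r: "r ^ 3 + A * r\<^sup>2 + B * r + C = 0" using real_cubic_root by blast
  define b c where "b = 3 * r + A" and "c = 3 * r\<^sup>2 + 2 * A * r + B"
  have c: "c \<noteq> 0" using nd[OF r] by (simp add: c_def)
  \<comment> \<open>The same device for the quartic, now with T^4 = T * T^3; at 0 the quartic has
    the value -c^2.\<close>
  define T where "T = 1 + 4 * \<bar>b\<bar> + 6 * \<bar>c\<bar> + c\<^sup>2"
  have T: "T \<ge> 1" by (simp add: T_def)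
  have "\<exists>t. 0 \<le> t \<and> t \<le> T \<and> 3 * t ^ 4 + 4 * b * t ^ 3 + 6 * c * t\<^sup>2 - c\<^sup>2 = 0"
  proof (rule IVT')
    have "1 \<le> T ^ 3" "T\<^sup>2 \<le> T ^ 3" using T power_increasing[of 2 3 T] by simp_all
    have "\<bar>4 * b * T ^ 3\<bar> \<le> 4 * \<bar>b\<bar> * T ^ 3" using T by (simp add: abs_mult)
    moreover have "\<bar>6 * c * T\<^sup>2\<bar> \<le> 6 * \<bar>c\<bar> * T ^ 3"
      using \<open>T\<^sup>2 \<le> T ^ 3\<close> by (simp add: abs_mult mult_left_mono)
    moreover have "c\<^sup>2 \<le> c\<^sup>2 * T ^ 3" using mult_left_mono[OF \<open>1 \<le> T ^ 3\<close>, of "c\<^sup>2"] by simp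
    moreover have "T ^ 4 = T ^ 3 + 4 * \<bar>b\<bar> * T ^ 3 + 6 * \<bar>c\<bar> * T ^ 3 + c\<^sup>2 * T ^ 3"
    proof -
      have "T ^ 4 = T * T ^ 3" by (simp add: power_numeral_reduce)
      also have "\<dots> = (1 + 4 * \<bar>b\<bar> + 6 * \<bar>c\<bar> + c\<^sup>2) * T ^ 3" by (simp add: T_def)
      finally show ?thesis by (simp add: algebra_simps)
    qed
    ultimately show "0 \<le> 3 * T ^ 4 + 4 * b * T ^ 3 + 6 * c * T\<^sup>2 - c\<^sup>2"
      using \<open>1 \<le> T ^ 3\<close> zero_le_power[of T 4] T by linarith
  qed (use T in \<open>auto intro!: continuous_intros\<close>)
  then obtain t where t: "0 \<le> t" "3 * t ^ 4 + 4 * b * t ^ 3 + 6 * c * t\<^sup>2 - c\<^sup>2 = 0" by blast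
  have t0: "t > 0" using t c by (cases "t = 0") auto
  define m where "m = sqrt t"
  have m: "m \<noteq> 0" "m\<^sup>2 = t" using t0 by (simp_all add: m_def)
  then have m4: "m ^ 4 = t\<^sup>2" by (simp add: power2_eq_square power4_eq_xxxx mult.assoc)
  \<comment> \<open>Dividing abscissas by \<open>t = m^2\<close> moves the 3-torsion abscissa to 1
    and turns the linear coefficient \<open>c\<close> into \<open>c / t^2\<close>, which has to be
    \<open>- a\<close>.\<close>
  define a where "a = - c / t\<^sup>2"
  have ca: "c = - a * t\<^sup>2" using t0 by (simp add: a_def)
  have "t ^ 3 * (4 * b) = t ^ 3 * (t * (a\<^sup>2 + 6 * a - 3))"
    using t(2) unfolding ca by (simp add: algebra_simps eval_nat_numeral)
  then have ba: "4 * b = t * (a\<^sup>2 + 6 * a - 3)" using t0 by simp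
  have shift: "(r + x) ^ 3 + A * (r + x)\<^sup>2 + B * (r + x) + C = x ^ 3 + b * x\<^sup>2 + c * x"
    "3 * (r + x)\<^sup>2 + 2 * A * (r + x) + B = 3 * x\<^sup>2 + 2 * b * x + c" for x
    using r unfolding b_def c_def
    by (algebra, simp add: algebra_simps power2_eq_square)
  have nd': "3 * x\<^sup>2 + 2 * b * x + c \<noteq> 0" if "x ^ 3 + b * x\<^sup>2 + c * x = 0" for x
    using nd[of "r + x"] that unfolding shift by simp
  have "a \<noteq> 0" using ca c by auto
  \<comment> \<open>For a = -1 the factor x^2 + b x + c is (x - t)^2, and for a = -9 it is (x + 3
    t)^2; both contradict the absence of multiple roots.\<close>
  moreover have "a \<noteq> -1"
  proof
    assume "a = -1"
    then have "c = t\<^sup>2" "b = - 2 * t" using ca ba by simp_all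
    then show False using nd'[of t] by (simp add: power3_eq_cube power2_eq_square)
  qed
  moreover have "a \<noteq> -9"
  proof
    assume "a = -9"
    then have "c = 9 * t\<^sup>2" "b = 6 * t" using ca ba by simp_all
    then show False using nd'[of "- 3 * t"] by (simp add: power3_eq_cube power2_eq_square)
  qed
  ultimately show ?thesis
    using that[of m a r] m m4 r ba ca unfolding b_def c_def by simp
qed

definition weierstrass :: "real \<Rightarrow> real \<Rightarrow> real \<Rightarrow> real \<Rightarrow> real \<Rightarrow> real \<Rightarrow> complex ^ 3 \<Rightarrow> complex" where
  "weierstrass a b c d e f = cubic (- c) 0 (- d) 0 a (- e) 0 1 b (- f)"

lemma real_form_weierstrass: "real_form 3 (weierstrass a b c d e f)"
  by (simp add: weierstrass_def real_form_cubic)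

lemma cmat_vector_nth:
  "cmat (vector [vector [a, b, c], vector [d, e, f], vector [g, h, i]]) *v v =
   vector [of_real a * v $ 1 + of_real b * v $ 2 + of_real c * v $ 3,
           of_real d * v $ 1 + of_real e * v $ 2 + of_real f * v $ 3,
           of_real g * v $ 1 + of_real h * v $ 2 + of_real i * v $ 3]"
  by (simp add: cmat_def matrix_vector_mult_def vec_eq_iff forall_3 sum_3)

lemma matrix_vector_nth:
  "(vector [vector [a, b, c], vector [d, e, f], vector [g, h, i]] :: real ^ 3 ^ 3) *v v =
   vector [a * v $ 1 + b * v $ 2 + c * v $ 3, d * v $ 1 + e * v $ 2 + f * v $ 3,
           g * v $ 1 + h * v $ 2 + i * v $ 3]"
  by (simp add: matrix_vector_mult_def vec_eq_iff forall_3 sum_3)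

lemma isomorphic_weierstrass_E_cubic:
  assumes a: "a \<noteq> 0" "a \<noteq> -1"
  shows "isomorphic_over_reals (weierstrass 0 0 1 ((a\<^sup>2 + 6 * a - 3) / 4) (- a) 0)
    (vector [0, 1, 0]) (E_cubic a) E_base"
proof -
  define u where "u = 1 / (a * (a + 1))"
  \<comment> \<open>Inverse of the substitution X = -a (y + z), Y = a (a + 1) (y - z) / 2, Z = y + z
    + (a + 1) x. Here Z = 0 is the flex tangent at the base point, X = 0 joins the base point to the
    point (1, 0, 0) of order 2, and interchanging y and z is negation.\<close>
  define A :: "real ^ 3 ^ 3" where
    "A = vector [vector [u, 0, 1 / (a + 1)], vector [- 1 / (2 * a), u, 0], vector [- 1 / (2 * a), - u, 0]]"
  have a1: "a + 1 \<noteq> 0" using a by auto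
  then have u: "u \<noteq> 0" using a by (simp add: u_def)
  show ?thesis
  proof (rule isomorphic_linear[OF real_form_E_cubic])
    have "det A = 1 / (a + 1) * (u / a)" by (simp add: A_def det_3)
    then show "det A \<noteq> 0" using u a a1 by simp
    \<comment> \<open>The factor can be read off on the flex tangent, where \<open>E_cubic\<close>
      restricts to a (a + 1) x^3 and the Weierstrass cubic to -X^3 = -a^3 (a + 1)^3 x^3.\<close>
    show "- (a\<^sup>2 * (a + 1)\<^sup>2) \<noteq> 0" using a a1 by simp
    show "A *v vector [0, 1, 0] = u *s E_base"
      by (simp add: A_def matrix_vector_nth E_base_def vec_eq_iff forall_3)
    show "weierstrass 0 0 1 ((a\<^sup>2 + 6 * a - 3) / 4) (- a) 0 v =
        of_real (- (a\<^sup>2 * (a + 1)\<^sup>2)) * E_cubic a (cmat A *v v)" for v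
    proof -
      define x y z where xyz: "x = (cmat A *v v) $ 1" "y = (cmat A *v v) $ 2" "z = (cmat A *v v) $ 3"
      define \<alpha> where "\<alpha> = complex_of_real a"
      have "\<alpha> + 1 = of_real (a + 1)" by (simp add: \<alpha>_def)
      then have al: "\<alpha> \<noteq> 0" "\<alpha> + 1 \<noteq> 0" "1 + \<alpha> \<noteq> 0" using a a1 by (simp_all add: \<alpha>_def add.commute del: of_real_add)
      define w where "w = 1 / (\<alpha> * (\<alpha> + 1))"
      have w: "\<alpha> * (\<alpha> + 1) * w = 1" "of_real u = w" "of_real (1 / (a + 1)) = \<alpha> * w"
        "of_real (- 1 / (2 * a)) = - ((\<alpha> + 1) * w / 2)"
        using al by (simp_all add: w_def u_def \<alpha>_def)
      have e: "x = w * v $ 1 + \<alpha> * w * v $ 3" "y = - ((\<alpha> + 1) * w / 2) * v $ 1 + w * v $ 2"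
         "z = - ((\<alpha> + 1) * w / 2) * v $ 1 - w * v $ 2"
        unfolding xyz A_def cmat_vector_nth w(2-4) of_real_minus by simp_all
      have v1: "v $ 1 = - \<alpha> * (y + z)" using w(1) unfolding e by algebra
      have v2: "v $ 2 = \<alpha> * (\<alpha> + 1) * (y - z) / 2" using w(1) unfolding e by algebra
      have v3: "v $ 3 = y + z + (\<alpha> + 1) * x" using w(1) unfolding e by algebra
      have "weierstrass 0 0 1 ((a\<^sup>2 + 6 * a - 3) / 4) (- a) 0 v
          = (v $ 2)\<^sup>2 * v $ 3 - (v $ 1) ^ 3 - (\<alpha>\<^sup>2 + 6 * \<alpha> - 3) / 4 * (v $ 1)\<^sup>2 * v $ 3
            + \<alpha> * v $ 1 * (v $ 3)\<^sup>2"
        by (simp add: weierstrass_def cubic_def \<alpha>_def Let_def)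
      also have "\<dots> = - (\<alpha>\<^sup>2 * (\<alpha> + 1)\<^sup>2) *
          (x\<^sup>2 * (y + z) + y\<^sup>2 * (x + z) + z\<^sup>2 * (x + y) + (\<alpha> + 3) * x * y * z)"
        unfolding v1 v2 v3 by (simp add: field_simps) algebra
      finally show ?thesis by (simp add: E_cubic_def Let_def xyz \<alpha>_def)
    qed
  qed (use u in \<open>auto simp: weierstrass_def cubic_def of_real_vec_def vec_eq_iff forall_3 Let_def\<close>)
qed

text \<open>Completing the square in Y leaves the cubic in the premise of \<open>nd\<close>. The
  conclusion of \<open>nd\<close> concerns half its derivative, so \<open>nd\<close> excludes
  multiple real roots.\<close>

lemma weierstrass_isomorphic_E_cubic:
  assumes c: "c \<noteq> 0"
    and nd: "\<And>x. 4 * (c * x ^ 3 + d * x\<^sup>2 + e * x + f) + (a * x + b)\<^sup>2 = 0 \<Longrightarrow>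
        2 * (3 * c * x\<^sup>2 + 2 * d * x + e) + a * (a * x + b) \<noteq> 0"
  shows "\<exists>q. q \<notin> {0, -1, -9} \<and>
    isomorphic_over_reals (weierstrass a b c d e f) (vector [0, 1, 0]) (E_cubic q) E_base"
proof -
  \<comment> \<open>(2 Y + a X + b)^2 is a cubic in X with leading coefficient 4 c. Multiplied by 16
    c^2 it becomes monic in 4 c X, with these coefficients.\<close>
  define A B C where "A = 4 * d + a\<^sup>2" and "B = 8 * c * (2 * e + a * b)"
    and "C = 16 * c\<^sup>2 * (4 * f + b\<^sup>2)"
  have nd': "3 * x\<^sup>2 + 2 * A * x + B \<noteq> 0" if x: "x ^ 3 + A * x\<^sup>2 + B * x + C = 0" for x
  proof -
    define y where "y = x / (4 * c)"
    have xy: "x = 4 * c * y" using c by (simp add: y_def)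
    have "16 * c\<^sup>2 * (4 * (c * y ^ 3 + d * y\<^sup>2 + e * y + f) + (a * y + b)\<^sup>2) = 0"
      using x unfolding xy A_def B_def C_def by algebra
    then have "2 * (3 * c * y\<^sup>2 + 2 * d * y + e) + a * (a * y + b) \<noteq> 0" using nd c by simp
    moreover have "3 * x\<^sup>2 + 2 * A * x + B = 8 * c * (2 * (3 * c * y\<^sup>2 + 2 * d * y + e) + a * (a * y + b))"
      unfolding xy A_def B_def by algebra
    ultimately show ?thesis using c by simp
  qed
  obtain r m q where q: "m \<noteq> 0" "q \<notin> {0, -1, -9}" "r ^ 3 + A * r\<^sup>2 + B * r + C = 0"
    "4 * (3 * r + A) = m\<^sup>2 * (q\<^sup>2 + 6 * q - 3)" "3 * r\<^sup>2 + 2 * A * r + B = - q * m ^ 4"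
    using three_torsion_parameter[OF nd'] by metis
  define W where "W = weierstrass 0 0 1 ((q\<^sup>2 + 6 * q - 3) / 4) (- q) 0"
  \<comment> \<open>Pass to the abscissa 4 c X and the ordinate 4 c (2 Y + a X + b), move the root
    \<open>r\<close> to the origin, and rescale with weights 2 and 3.\<close>
  define P :: "real ^ 3 ^ 3" where
    "P = vector [vector [4 * c / m\<^sup>2, 0, - r / m\<^sup>2],
                 vector [4 * c * a / m ^ 3, 8 * c / m ^ 3, 4 * c * b / m ^ 3], vector [0, 0, 1]]"
  have "isomorphic_over_reals (weierstrass a b c d e f) (vector [0, 1, 0]) W (vector [0, 1, 0])"
  proof (rule isomorphic_linear)
    show "real_form 3 W" by (simp add: W_def real_form_weierstrass)
    show "det P \<noteq> 0" using c q(1) by (simp add: P_def det_3)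
    show "P *v vector [0, 1, 0] = (8 * c / m ^ 3) *s vector [0, 1, 0]"
      by (simp add: P_def matrix_vector_nth vec_eq_iff forall_3)
    show "m ^ 6 / (64 * c\<^sup>2) \<noteq> 0" "8 * c / m ^ 3 \<noteq> 0" using c q(1) by simp_all
    show "weierstrass a b c d e f v = of_real (m ^ 6 / (64 * c\<^sup>2)) * W (cmat P *v v)" for v
    proof -
      define X Y Z where XYZ: "X = v $ 1" "Y = v $ 2" "Z = v $ 3"
      define a' b' c' d' e' f' r' m' q' where
        cs: "a' = complex_of_real a" "b' = complex_of_real b" "c' = complex_of_real c"
        "d' = complex_of_real d" "e' = complex_of_real e" "f' = complex_of_real f"
        "r' = complex_of_real r" "m' = complex_of_real m" "q' = complex_of_real q"
      define S T where "S = (4 * c' * X - r' * Z) / m'\<^sup>2"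
        and "T = 4 * c' * (a' * X + 2 * Y + b' * Z) / m' ^ 3"
      have nz: "m' \<noteq> 0" "c' \<noteq> 0" using c q(1) by (simp_all add: cs)
      have S: "m'\<^sup>2 * S = 4 * c' * X - r' * Z" and T: "m' ^ 3 * T = 4 * c' * (a' * X + 2 * Y + b' * Z)"
        using nz by (simp_all add: S_def T_def)
      have 1: "r' ^ 3 + (4 * d' + a'\<^sup>2) * r'\<^sup>2 + 8 * c' * (2 * e' + a' * b') * r'
          + 16 * c'\<^sup>2 * (4 * f' + b'\<^sup>2) = 0"
        using arg_cong[OF q(3), of complex_of_real] by (simp add: A_def B_def C_def cs)
      have 2: "4 * (3 * r' + (4 * d' + a'\<^sup>2)) = m'\<^sup>2 * (q'\<^sup>2 + 6 * q' - 3)"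
        using arg_cong[OF q(4), of complex_of_real] by (simp add: A_def cs)
      have 3: "3 * r'\<^sup>2 + 2 * (4 * d' + a'\<^sup>2) * r' + 8 * c' * (2 * e' + a' * b') = - q' * m' ^ 4"
        using arg_cong[OF q(5), of complex_of_real] by (simp add: A_def B_def cs)
      \<comment> \<open>After clearing denominators, \<open>q'\<close> occurs only in the two
        combinations given by facts 2 and 3. Eliminating it leaves an identity modulo fact 1, that
        \<open>r\<close> is a root.\<close>
      have "4 * m' ^ 6 * (T\<^sup>2 * Z - S ^ 3 - (q'\<^sup>2 + 6 * q' - 3) / 4 * S\<^sup>2 * Z + q' * S * Z\<^sup>2)
          = 4 * (m' ^ 3 * T)\<^sup>2 * Z - 4 * (m'\<^sup>2 * S) ^ 3
            - m'\<^sup>2 * (q'\<^sup>2 + 6 * q' - 3) * (m'\<^sup>2 * S)\<^sup>2 * Z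
            - 4 * (- q' * m' ^ 4) * (m'\<^sup>2 * S) * Z\<^sup>2"
        by (simp add: field_simps eval_nat_numeral)
      also have "\<dots> = 256 * c'\<^sup>2 * (Y\<^sup>2 * Z + a' * X * Y * Z + b' * Y * Z\<^sup>2
          - c' * X ^ 3 - d' * X\<^sup>2 * Z - e' * X * Z\<^sup>2 - f' * Z ^ 3)"
        unfolding S T 2[symmetric] 3[symmetric] using 1 by algebra
      finally have eq: "4 * m' ^ 6 * (T\<^sup>2 * Z - S ^ 3 - (q'\<^sup>2 + 6 * q' - 3) / 4 * S\<^sup>2 * Z + q' * S * Z\<^sup>2)
          = 256 * c'\<^sup>2 * (Y\<^sup>2 * Z + a' * X * Y * Z + b' * Y * Z\<^sup>2
            - c' * X ^ 3 - d' * X\<^sup>2 * Z - e' * X * Z\<^sup>2 - f' * Z ^ 3)" .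
      have "R = M / (64 * K) * L" if "4 * M * L = 256 * K * R" "K \<noteq> 0" for R M K L :: complex
      proof -
        have "64 * K * R = M * L" using that(1) by algebra
        then show ?thesis using that(2) by (simp add: field_simps)
      qed
      from this[OF eq] have "Y\<^sup>2 * Z + a' * X * Y * Z + b' * Y * Z\<^sup>2
            - c' * X ^ 3 - d' * X\<^sup>2 * Z - e' * X * Z\<^sup>2 - f' * Z ^ 3 = m' ^ 6 / (64 * c'\<^sup>2) *
          (T\<^sup>2 * Z - S ^ 3 - (q'\<^sup>2 + 6 * q' - 3) / 4 * S\<^sup>2 * Z + q' * S * Z\<^sup>2)"
        using nz by simp
      moreover have "cmat P *v v = vector [S, T, Z]"
        unfolding P_def cmat_vector_nth
        by (simp add: vec_eq_iff forall_3 S_def T_def cs XYZ add_divide_distrib diff_divide_distrib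
            algebra_simps)
      ultimately show ?thesis
        by (simp add: W_def weierstrass_def cubic_def Let_def cs XYZ algebra_simps)
    qed
  qed (auto simp: weierstrass_def cubic_def of_real_vec_def vec_eq_iff forall_3 Let_def)
  moreover have "isomorphic_over_reals W (vector [0, 1, 0]) (E_cubic q) E_base"
    unfolding W_def using q(2) by (intro isomorphic_weierstrass_E_cubic) auto
  ultimately show ?thesis
    using isomorphic_over_reals_trans real_form_weierstrass q(2) unfolding W_def by blast
qed

section \<open>Nagell's quadratic transformation\<close>

text \<open>The tangent at (1, 0, 0) is z = 0, which meets the curve again at (0, 1, 0), where the
  tangent is x = 0. With z = 1, multiplying the equation by x gives a Weierstrass equation in x and
  x y.\<close>

definition nagell :: "real \<Rightarrow> real \<Rightarrow> real \<Rightarrow> real \<Rightarrow> real \<Rightarrow> complex ^ 3 \<Rightarrow> complex" where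
  "nagell a b c d e = cubic 0 0 (- c) 1 a (- d) 0 0 b (- e)"

lemma real_form_nth_mult: "real_form 2 (\<lambda>v. v $ i * v $ j)"
  using real_form_mult[OF real_form_nth real_form_nth] by (simp add: numeral_2_eq_2)

lemma real_form_diff: "real_form d F \<Longrightarrow> real_form d G \<Longrightarrow> real_form d (\<lambda>v. F v - G v)"
  using real_form_add[of d F "\<lambda>v. of_real (- 1) * G v"] real_form_scale[of d G "- 1"] by simp

text \<open>
  The triple \<open>(x z, x y, z\<^sup>2)\<close> vanishes at \<open>(1, 0, 0)\<close> and \<open>(0, 1, 0)\<close>. Writing the equation of the
  curve as \<open>x y\<^sup>2 = z M\<close> and as \<open>x N = z\<^sup>2 K\<close>, multiply the triple by \<open>M\<close> and divide by \<open>x y\<close>,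
  respectively multiply it by \<open>N\<close> and divide by \<open>z\<^sup>2\<close>. The inverse is treated in the same way.
\<close>

definition nagell_maps ::
  "real \<Rightarrow> real \<Rightarrow> real \<Rightarrow> real \<Rightarrow> real \<Rightarrow> (complex ^ 3 \<Rightarrow> complex ^ 3) set" where
  "nagell_maps a b c d e =
    {\<lambda>v. vector [v $ 1 * v $ 3, v $ 1 * v $ 2, v $ 3 * v $ 3],
     \<lambda>v. vector [v $ 1 * v $ 2,
       of_real c * (v $ 1 * v $ 1) + of_real d * (v $ 1 * v $ 3) + of_real e * (v $ 3 * v $ 3)
         - of_real a * (v $ 1 * v $ 2) - of_real b * (v $ 2 * v $ 3),
       v $ 2 * v $ 3],
     \<lambda>v. vector [of_real e * (v $ 3 * v $ 3) - of_real b * (v $ 2 * v $ 3),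
       of_real e * (v $ 2 * v $ 3) - of_real b * (v $ 2 * v $ 2),
       v $ 2 * v $ 2 + of_real a * (v $ 2 * v $ 3) - of_real c * (v $ 1 * v $ 3)
         - of_real d * (v $ 3 * v $ 3)]}"

definition nagell_inverse_maps ::
  "real \<Rightarrow> real \<Rightarrow> real \<Rightarrow> real \<Rightarrow> real \<Rightarrow> (complex ^ 3 \<Rightarrow> complex ^ 3) set" where
  "nagell_inverse_maps a b c d e =
    {\<lambda>v. vector [v $ 1 * v $ 1, v $ 2 * v $ 3, v $ 1 * v $ 3],
     \<lambda>v. vector [v $ 2 * v $ 2 + of_real a * (v $ 1 * v $ 2) + of_real b * (v $ 2 * v $ 3)
         - of_real d * (v $ 1 * v $ 1) - of_real e * (v $ 1 * v $ 3),
       of_real c * (v $ 1 * v $ 2), of_real c * (v $ 1 * v $ 1)],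
     \<lambda>v. vector [v $ 1 * v $ 2 + of_real a * (v $ 1 * v $ 1) + of_real b * (v $ 1 * v $ 3),
       of_real c * (v $ 1 * v $ 1) + of_real d * (v $ 1 * v $ 3) + of_real e * (v $ 3 * v $ 3),
       v $ 2 * v $ 3 + of_real a * (v $ 1 * v $ 3) + of_real b * (v $ 3 * v $ 3)]}"

lemma form_map_nagell:
  "h \<in> nagell_maps a b c d e \<Longrightarrow> form_map 2 h"
  "k \<in> nagell_inverse_maps a b c d e \<Longrightarrow> form_map 2 k"
  unfolding nagell_maps_def nagell_inverse_maps_def form_map_def forall_3
  by (elim insertE emptyE; hypsubst; simp only: vector_3;
      intro conjI real_form_add real_form_diff real_form_scale real_form_nth_mult)+

lemma nagell_eq:
  "nagell a b c d e v = 0 \<longleftrightarrow>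
     v $ 1 * v $ 2 * v $ 2 + of_real a * v $ 1 * v $ 2 * v $ 3 + of_real b * v $ 2 * v $ 3 * v $ 3
     - of_real c * v $ 1 * v $ 1 * v $ 3 - of_real d * v $ 1 * v $ 3 * v $ 3
     - of_real e * v $ 3 * v $ 3 * v $ 3 = 0"
  by (simp add: nagell_def cubic_def Let_def power2_eq_square power3_eq_cube algebra_simps)

lemma weierstrass_eq:
  "weierstrass a b c d e 0 v = 0 \<longleftrightarrow>
     v $ 2 * v $ 2 * v $ 3 + of_real a * v $ 1 * v $ 2 * v $ 3 + of_real b * v $ 2 * v $ 3 * v $ 3
     - of_real c * v $ 1 * v $ 1 * v $ 1 - of_real d * v $ 1 * v $ 1 * v $ 3
     - of_real e * v $ 1 * v $ 3 * v $ 3 = 0"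
  by (simp add: weierstrass_def cubic_def Let_def power2_eq_square power3_eq_cube algebra_simps)

lemma nagell_maps_cases:
  assumes "h \<in> nagell_maps a b c d e"
  obtains "h u = vector [u $ 1 * u $ 3, u $ 1 * u $ 2, u $ 3 * u $ 3]"
  | "h u = vector [u $ 1 * u $ 2,
       of_real c * (u $ 1 * u $ 1) + of_real d * (u $ 1 * u $ 3) + of_real e * (u $ 3 * u $ 3)
         - of_real a * (u $ 1 * u $ 2) - of_real b * (u $ 2 * u $ 3),
       u $ 2 * u $ 3]"
  | "h u = vector [of_real e * (u $ 3 * u $ 3) - of_real b * (u $ 2 * u $ 3),
       of_real e * (u $ 2 * u $ 3) - of_real b * (u $ 2 * u $ 2),
       u $ 2 * u $ 2 + of_real a * (u $ 2 * u $ 3) - of_real c * (u $ 1 * u $ 3)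
         - of_real d * (u $ 3 * u $ 3)]"
  using assms unfolding nagell_maps_def by blast

lemma nagell_inverse_maps_cases:
  assumes "k \<in> nagell_inverse_maps a b c d e"
  obtains "k u = vector [u $ 1 * u $ 1, u $ 2 * u $ 3, u $ 1 * u $ 3]"
  | "k u = vector [u $ 2 * u $ 2 + of_real a * (u $ 1 * u $ 2) + of_real b * (u $ 2 * u $ 3)
         - of_real d * (u $ 1 * u $ 1) - of_real e * (u $ 1 * u $ 3),
       of_real c * (u $ 1 * u $ 2), of_real c * (u $ 1 * u $ 1)]"
  | "k u = vector [u $ 1 * u $ 2 + of_real a * (u $ 1 * u $ 1) + of_real b * (u $ 1 * u $ 3),
       of_real c * (u $ 1 * u $ 1) + of_real d * (u $ 1 * u $ 3) + of_real e * (u $ 3 * u $ 3),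
       u $ 2 * u $ 3 + of_real a * (u $ 1 * u $ 3) + of_real b * (u $ 3 * u $ 3)]"
  using assms unfolding nagell_inverse_maps_def by blast

text \<open>For each triple the claim is a polynomial identity, either outright or modulo the
  equation of the curve; hence the two alternatives in the proof method.\<close>

lemma nagell_maps_into:
  assumes "h \<in> nagell_maps a b c d e" "nagell a b c d e u = 0"
  shows "weierstrass a b c d e 0 (h u) = 0"
  unfolding weierstrass_eq
  by (rule nagell_maps_cases[OF assms(1), of u]; erule ssubst; simp only: vector_3;
      ((simp add: algebra_simps; fail) | insert assms(2)[unfolded nagell_eq], algebra))

lemma nagell_inverse_maps_into:
  assumes "k \<in> nagell_inverse_maps a b c d e" "weierstrass a b c d e 0 u = 0"
  shows "nagell a b c d e (k u) = 0"
  unfolding nagell_eq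
  by (rule nagell_inverse_maps_cases[OF assms(1), of u]; erule ssubst; simp only: vector_3;
      ((simp add: algebra_simps; fail) | insert assms(2)[unfolded weierstrass_eq], algebra))

text \<open>Two nonzero vectors represent the same point when their 2 by 2 minors vanish, which
  again is a matter of identities modulo the cubic.\<close>

lemma nagell_maps_compatible:
  assumes "h \<in> nagell_maps a b c d e" "h' \<in> nagell_maps a b c d e" "nagell a b c d e u = 0"
    "h u \<noteq> 0" "h' u \<noteq> 0"
  shows "ppoint (h u) = ppoint (h' u)"
proof -
  have "h u $ 1 * h' u $ 2 = h u $ 2 * h' u $ 1 \<and> h u $ 1 * h' u $ 3 = h u $ 3 * h' u $ 1 \<and>
      h u $ 2 * h' u $ 3 = h u $ 3 * h' u $ 2"
    by (rule nagell_maps_cases[OF assms(1), of u]; erule ssubst;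
        rule nagell_maps_cases[OF assms(2), of u]; erule ssubst; simp only: vector_3;
        intro conjI;
        ((simp add: algebra_simps; fail) | insert assms(3)[unfolded nagell_eq], algebra))
  then show ?thesis using ppoint_eqI[OF assms(4,5)] by blast
qed

lemma nagell_inverse_maps_compatible:
  assumes "k \<in> nagell_inverse_maps a b c d e" "k' \<in> nagell_inverse_maps a b c d e"
    "weierstrass a b c d e 0 u = 0" "k u \<noteq> 0" "k' u \<noteq> 0"
  shows "ppoint (k u) = ppoint (k' u)"
proof -
  have "k u $ 1 * k' u $ 2 = k u $ 2 * k' u $ 1 \<and> k u $ 1 * k' u $ 3 = k u $ 3 * k' u $ 1 \<and>
      k u $ 2 * k' u $ 3 = k u $ 3 * k' u $ 2"
    by (rule nagell_inverse_maps_cases[OF assms(1), of u]; erule ssubst;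
        rule nagell_inverse_maps_cases[OF assms(2), of u]; erule ssubst; simp only: vector_3;
        intro conjI;
        ((simp add: algebra_simps; fail) | insert assms(3)[unfolded weierstrass_eq], algebra))
  then show ?thesis using ppoint_eqI[OF assms(4,5)] by blast
qed

lemma nagell_inverse_maps_inverse:
  assumes "h \<in> nagell_maps a b c d e" "k \<in> nagell_inverse_maps a b c d e"
    "nagell a b c d e u = 0" "k (h u) \<noteq> 0" "u \<noteq> 0"
  shows "ppoint (k (h u)) = ppoint u"
proof -
  have "k (h u) $ 1 * u $ 2 = k (h u) $ 2 * u $ 1 \<and> k (h u) $ 1 * u $ 3 = k (h u) $ 3 * u $ 1 \<and>
      k (h u) $ 2 * u $ 3 = k (h u) $ 3 * u $ 2"
    by (rule nagell_inverse_maps_cases[OF assms(2), of "h u"]; erule ssubst;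
        rule nagell_maps_cases[OF assms(1), of u]; erule ssubst; simp only: vector_3;
        intro conjI;
        ((simp add: algebra_simps; fail) | insert assms(3)[unfolded nagell_eq], algebra))
  then show ?thesis using ppoint_eqI[OF assms(4,5)] by blast
qed

lemma nagell_maps_inverse:
  assumes "h \<in> nagell_maps a b c d e" "k \<in> nagell_inverse_maps a b c d e"
    "weierstrass a b c d e 0 u = 0" "h (k u) \<noteq> 0" "u \<noteq> 0"
  shows "ppoint (h (k u)) = ppoint u"
proof -
  have "h (k u) $ 1 * u $ 2 = h (k u) $ 2 * u $ 1 \<and> h (k u) $ 1 * u $ 3 = h (k u) $ 3 * u $ 1 \<and>
      h (k u) $ 2 * u $ 3 = h (k u) $ 3 * u $ 2"
    by (rule nagell_maps_cases[OF assms(1), of "k u"]; erule ssubst;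
        rule nagell_inverse_maps_cases[OF assms(2), of u]; erule ssubst; simp only: vector_3;
        intro conjI;
        ((simp add: algebra_simps; fail) | insert assms(3)[unfolded weierstrass_eq], algebra))
  then show ?thesis using ppoint_eqI[OF assms(4,5)] by blast
qed

text \<open>Nonsingularity is not transported along the quadratic map. The conditions on the
  Weierstrass cubic are derived from the Nagell cubic instead, by pulling back a hypothetical
  singular point.\<close>

lemma nagell_isomorphic_weierstrass:
  assumes E: "elliptic_curve (nagell a b c d e) (vector [1, 0, 0])"
  shows "c \<noteq> 0"
    and "isomorphic_over_reals (nagell a b c d e) (vector [1, 0, 0])
          (weierstrass a b c d e 0) (vector [0, 1, 0])"
    and "\<And>x. 4 * (c * x ^ 3 + d * x\<^sup>2 + e * x) + (a * x + b)\<^sup>2 = 0 \<Longrightarrow>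
        2 * (3 * c * x\<^sup>2 + 2 * d * x + e) + a * (a * x + b) \<noteq> 0"
proof -
  have ns: "nonsingular (nagell a b c d e)" and p: "nagell a b c d e (of_real_vec (vector [1, 0, 0])) = 0"
    using E by (auto simp: elliptic_curve_def)
  note sing = nonsingular_cubicD[OF ns[unfolded nagell_def]]
  show c: "c \<noteq> 0"
  proof
    assume "c = 0"
    then show False using sing[of 1 0 0] by (simp add: cubic_def)
  qed
  have be: "b \<noteq> 0 \<or> e \<noteq> 0"
  proof (rule ccontr)
    \<comment> \<open>Otherwise x = 0 is a component, and it meets the residual conic at (0, y, 1),
      a singular point.\<close>
    assume be: "\<not> ?thesis"
    define y where "y = (csqrt (of_real (a\<^sup>2 + 4 * d)) - of_real a) / 2"
    have "(2 * y + of_real a)\<^sup>2 = of_real a ^ 2 + 4 * of_real d"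
      by (simp add: y_def add_divide_distrib diff_divide_distrib)
    then have "y\<^sup>2 + of_real a * y - of_real d = 0" by algebra
    then show False using sing[of 0 y 1] be by (simp add: cubic_def algebra_simps)
  qed
  show "2 * (3 * c * x\<^sup>2 + 2 * d * x + e) + a * (a * x + b) \<noteq> 0"
    if h: "4 * (c * x ^ 3 + d * x\<^sup>2 + e * x) + (a * x + b)\<^sup>2 = 0" for x
  proof
    assume h': "2 * (3 * c * x\<^sup>2 + 2 * d * x + e) + a * (a * x + b) = 0"
    \<comment> \<open>At x = 0 the two equations would give b = 0 and then e = 0.\<close>
    have "x \<noteq> 0"
      using h h' be by auto
    define a' b' c' d' e' x' where cs: "a' = complex_of_real a" "b' = complex_of_real b"
      "c' = complex_of_real c" "d' = complex_of_real d" "e' = complex_of_real e" "x' = complex_of_real x"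
    \<comment> \<open>The Weierstrass cubic would be singular at (x, y, 1), \<open>y\<close> being
      the double root of its equation in Y. The first inverse triple takes this point to (x^2, y,
      x), which is tested below.\<close>
    define y where "y = - (a' * x' + b') / 2"
    have y: "2 * y = - (a' * x' + b')" by (simp add: y_def)
    have 1: "4 * (c' * x' ^ 3 + d' * x'\<^sup>2 + e' * x') + (a' * x' + b')\<^sup>2 = 0"
      using arg_cong[OF h, of complex_of_real] by (simp add: cs)
    have 2: "2 * (3 * c' * x'\<^sup>2 + 2 * d' * x' + e') + a' * (a' * x' + b') = 0"
      using arg_cong[OF h', of complex_of_real] by (simp add: cs)
    have 3: "y\<^sup>2 = - (c' * x' ^ 3 + d' * x'\<^sup>2 + e' * x')" "3 * c' * x'\<^sup>2 + 2 * d' * x' + e' = a' * y"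
      using 1 2 y by algebra+
    have "x'\<^sup>2 * y\<^sup>2 + a' * x'\<^sup>2 * y * x' + b' * y * x'\<^sup>2 - c' * (x'\<^sup>2)\<^sup>2 * x'
         - d' * x'\<^sup>2 * x'\<^sup>2 - e' * x' ^ 3 = 0"
      "y\<^sup>2 + a' * y * x' - 2 * c' * x'\<^sup>2 * x' - d' * x'\<^sup>2 = 0"
      "2 * x'\<^sup>2 * y + a' * x'\<^sup>2 * x' + b' * x'\<^sup>2 = 0"
      "a' * x'\<^sup>2 * y + 2 * b' * y * x' - c' * (x'\<^sup>2)\<^sup>2 - 2 * d' * x'\<^sup>2 * x' - 3 * e' * x'\<^sup>2 = 0"
      using 3 y by algebra+
    then have "x' = 0"
      using sing[of "x'\<^sup>2" y x'] by (simp add: cubic_def cs[symmetric] algebra_simps)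
    then show False using \<open>x \<noteq> 0\<close> cs by simp
  qed
  \<comment> \<open>At (1, 0, 0) only the second triple is nonzero, with value (0, c, 0); it
    therefore serves as \<open>h\<^sub>0\<close>.\<close>
  show "isomorphic_over_reals (nagell a b c d e) (vector [1, 0, 0])
      (weierstrass a b c d e 0) (vector [0, 1, 0])"
  proof (rule isomorphic_of_atlas[where \<H> = "nagell_maps a b c d e" and \<K> = "nagell_inverse_maps a b c d e"
        and h\<^sub>0 = "\<lambda>v. vector [v $ 1 * v $ 2,
          of_real c * (v $ 1 * v $ 1) + of_real d * (v $ 1 * v $ 3) + of_real e * (v $ 3 * v $ 3)
            - of_real a * (v $ 1 * v $ 2) - of_real b * (v $ 2 * v $ 3),
          v $ 2 * v $ 3]" and c = "of_real c" and m = 3 and n = 3])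
    show "atlas (nagell a b c d e) (weierstrass a b c d e 0) (nagell_maps a b c d e)"
      unfolding atlas_def
    proof (intro conjI ballI allI impI; (elim conjE)?)
      fix u assume u: "u \<noteq> 0" "nagell a b c d e u = 0"
      show "\<exists>h\<in>nagell_maps a b c d e. h u \<noteq> 0"
      proof (cases "u $ 3 = 0")
        case False
        then show ?thesis by (auto simp: nagell_maps_def vec_eq_iff forall_3)
      next
        case True
        \<comment> \<open>Two points have z = 0: the third triple is nonzero at (0, 1, 0), the
          second at (1, 0, 0).\<close>
        then have "u $ 1 = 0 \<or> u $ 2 = 0" using u(2) by (auto simp: nagell_eq)
        then consider "u $ 1 = 0" "u $ 2 \<noteq> 0" | "u $ 2 = 0" "u $ 1 \<noteq> 0"
          using u(1) True by (auto simp: vec_eq_iff forall_3)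
        then show ?thesis
          by cases (use True c in \<open>auto simp: nagell_maps_def vec_eq_iff forall_3\<close>)
      qed
    qed (blast intro: form_map_nagell, erule (1) nagell_maps_into,
        erule (4) nagell_maps_compatible)
    show "atlas (weierstrass a b c d e 0) (nagell a b c d e) (nagell_inverse_maps a b c d e)"
      unfolding atlas_def
    proof (intro conjI ballI allI impI; (elim conjE)?)
      fix u assume u: "u \<noteq> 0" "weierstrass a b c d e 0 u = 0"
      show "\<exists>h\<in>nagell_inverse_maps a b c d e. h u \<noteq> 0"
      proof (cases "u $ 1 = 0")
        case False
        then show ?thesis by (auto simp: nagell_inverse_maps_def vec_eq_iff forall_3)
      next
        case True
        \<comment> \<open>At (0, 0, 1) the third triple has the value (0, e, b), nonzero by
          \<open>be\<close>. If \<open>u $ 2\<close> is nonzero, the first or the second triple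
          works according to whether \<open>u $ 3\<close> is nonzero.\<close>
        then consider "u $ 2 = 0" "u $ 3 \<noteq> 0" | "u $ 2 \<noteq> 0"
          using u(1) by (auto simp: vec_eq_iff forall_3)
        then show ?thesis
          by cases (use True be in \<open>auto simp: nagell_inverse_maps_def vec_eq_iff forall_3\<close>)
      qed
    qed (blast intro: form_map_nagell, erule (1) nagell_inverse_maps_into,
        erule (4) nagell_inverse_maps_compatible)
  qed (use p c nagell_inverse_maps_inverse nagell_maps_inverse in
      \<open>auto simp: nagell_def weierstrass_def real_form_cubic nagell_maps_def of_real_vec_def vec_eq_iff forall_3\<close>)
qed

section \<open>Normal forms of cubics with a base point\<close>

lemma weierstrass_nonsingularD:
  assumes "nonsingular (weierstrass a b c d e f)"
  shows "c \<noteq> 0"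
    and "\<And>x. 4 * (c * x ^ 3 + d * x\<^sup>2 + e * x + f) + (a * x + b)\<^sup>2 = 0 \<Longrightarrow>
        2 * (3 * c * x\<^sup>2 + 2 * d * x + e) + a * (a * x + b) \<noteq> 0"
proof -
  note sing = nonsingular_cubicD[OF assms[unfolded weierstrass_def]]
  show "c \<noteq> 0"
  proof
    assume c: "c = 0"
    \<comment> \<open>For c = 0 the line z = 0 is a component, meeting the residual conic at the
      singular point (1, y, 0).\<close>
    define y where "y = (csqrt (of_real (a\<^sup>2 + 4 * d)) - of_real a) / 2"
    have "(2 * y + of_real a)\<^sup>2 = of_real a ^ 2 + 4 * of_real d"
      by (simp add: y_def add_divide_distrib diff_divide_distrib)
    then have "y\<^sup>2 + of_real a * y - of_real d = 0" by algebra
    then show False using sing[of 1 y 0] c by (simp add: cubic_def algebra_simps)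
  qed
  show "2 * (3 * c * x\<^sup>2 + 2 * d * x + e) + a * (a * x + b) \<noteq> 0"
    if h: "4 * (c * x ^ 3 + d * x\<^sup>2 + e * x + f) + (a * x + b)\<^sup>2 = 0" for x
  proof
    assume h': "2 * (3 * c * x\<^sup>2 + 2 * d * x + e) + a * (a * x + b) = 0"
    define a' b' c' d' e' f' x' where cs: "a' = complex_of_real a" "b' = complex_of_real b"
      "c' = complex_of_real c" "d' = complex_of_real d" "e' = complex_of_real e"
      "f' = complex_of_real f" "x' = complex_of_real x"
    define y where "y = - (a' * x' + b') / 2"
    have y: "2 * y = - (a' * x' + b')" by (simp add: y_def)
    have 1: "4 * (c' * x' ^ 3 + d' * x'\<^sup>2 + e' * x' + f') + (a' * x' + b')\<^sup>2 = 0"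
      using arg_cong[OF h, of complex_of_real] by (simp add: cs)
    have 2: "2 * (3 * c' * x'\<^sup>2 + 2 * d' * x' + e') + a' * (a' * x' + b') = 0"
      using arg_cong[OF h', of complex_of_real] by (simp add: cs)
    have "x' = 0 \<and> y = 0 \<and> (1 :: complex) = 0"
      by (rule sing; simp add: cubic_def cs[symmetric]; use 1 2 y in algebra)
    then show False by simp
  qed
qed

lemma of_real_vec_3: "of_real_vec (vector [x, y, z]) = vector [of_real x, of_real y, of_real z]"
  by (simp add: of_real_vec_def vec_eq_iff forall_3)

lemma cubic_euler:
  "v $ 1 * partial (cubic a b c d e f g h i j) 1 v + v $ 2 * partial (cubic a b c d e f g h i j) 2 v
    + v $ 3 * partial (cubic a b c d e f g h i j) 3 v = 3 * cubic a b c d e f g h i j v"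
  unfolding partial_cubic cubic_def Let_def by algebra

lemma partial_cubic_Reals: "partial (cubic a b c d e f g h i j) l (of_real_vec p) \<in> \<real>"
  using exhaust_3[of l]
  by (auto simp: partial_cubic of_real_vec_def intro!: Reals_add Reals_mult Reals_power)

text \<open>Moving the base point to (1, 0, 0) removes x^3, and making z = 0 its tangent removes x^2
  y; smoothness at the base point is then c \<noteq> 0.\<close>

lemma elliptic_curve_tangent_frame:
  assumes E: "elliptic_curve F p"
  obtains c d e f g h i j where "c \<noteq> 0"
    "elliptic_curve (cubic 0 0 c d e f g h i j) (vector [1, 0, 0])"
    "isomorphic_over_reals F p (cubic 0 0 c d e f g h i j) (vector [1, 0, 0])"
proof -
  have F: "real_form 3 F" "nonsingular F" "p \<noteq> 0" "F (of_real_vec p) = 0"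
    using E by (auto simp: elliptic_curve_def)
  define n :: "real ^ 3" where "n = (\<chi> l. Re (partial F l (of_real_vec p)))"
  have n: "partial F l (of_real_vec p) = of_real (n $ l)" for l
    using F(1) partial_cubic_Reals unfolding real_form_3_iff n_def by fastforce
  have "of_real_vec p \<noteq> 0" using F(3) by (auto simp: of_real_vec_def vec_eq_iff)
  then obtain l where "partial F l (of_real_vec p) \<noteq> 0"
    using F(2,4) unfolding nonsingular_def by metis
  then have n0: "n \<noteq> 0" using n by auto
  have "of_real (p $ 1 * n $ 1 + p $ 2 * n $ 2 + p $ 3 * n $ 3) = (0 :: complex)"
  proof -
    have "of_real_vec p $ 1 * partial F 1 (of_real_vec p) + of_real_vec p $ 2 * partial F 2 (of_real_vec p)
      + of_real_vec p $ 3 * partial F 3 (of_real_vec p) = 3 * F (of_real_vec p)"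
      using F(1) cubic_euler unfolding real_form_3_iff by fastforce
    then show ?thesis unfolding n F(4) by (simp add: of_real_vec_def)
  qed
  then have pn: "p $ 1 * n $ 1 + p $ 2 * n $ 2 + p $ 3 * n $ 3 = 0" by (simp only: of_real_eq_0_iff)
  \<comment> \<open>The columns are p, n x p and n, with n the gradient at p. Euler's relation makes
    p and n orthogonal, so by Lagrange's identity the determinant is |p|^2 |n|^2. The first two
    columns span the tangent line.\<close>
  define B :: "real ^ 3 ^ 3" where
    "B = vector [vector [p $ 1, n $ 2 * p $ 3 - n $ 3 * p $ 2, n $ 1],
                 vector [p $ 2, n $ 3 * p $ 1 - n $ 1 * p $ 3, n $ 2],
                 vector [p $ 3, n $ 1 * p $ 2 - n $ 2 * p $ 1, n $ 3]]"
  have "det B = ((p $ 1)\<^sup>2 + (p $ 2)\<^sup>2 + (p $ 3)\<^sup>2) * ((n $ 1)\<^sup>2 + (n $ 2)\<^sup>2 + (n $ 3)\<^sup>2)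
      - (p $ 1 * n $ 1 + p $ 2 * n $ 2 + p $ 3 * n $ 3)\<^sup>2"
    unfolding B_def det_3 vector_3 by algebra
  moreover have "(v $ 1)\<^sup>2 + (v $ 2)\<^sup>2 + (v $ 3)\<^sup>2 \<noteq> 0" if "v \<noteq> 0" for v :: "real ^ 3"
    using that by (auto simp: vec_eq_iff forall_3 add_nonneg_eq_0_iff)
  ultimately have B: "det B \<noteq> 0" using pn F(3) n0 by simp
  have Bp: "B *v vector [1, 0, 0] = p"
    by (simp add: B_def matrix_vector_nth vec_eq_iff forall_3)
  define G where "G = (\<lambda>v. of_real 1 * F (cmat B *v v))"
  have G: "elliptic_curve G (vector [1, 0, 0])" "isomorphic_over_reals F p G (vector [1, 0, 0])"
    using elliptic_curve_linear[of F B "vector [1, 0, 0]" 1] E B unfolding Bp G_def by simp_all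
  then obtain a b c d e f g h i j where cubic: "G = cubic a b c d e f g h i j"
    unfolding elliptic_curve_def real_form_3_iff by metis
  have a: "a = 0" using G(1) by (simp add: cubic elliptic_curve_def of_real_vec_3 cubic_def)
  have "partial G 2 (vector [1, 0, 0]) = 0"
  proof -
    have Bp': "cmat B *v vector [1, 0, 0] = of_real_vec p"
      using cmat_mult_of_real_vec[of B "vector [1, 0, 0]"] Bp by (simp add: of_real_vec_3)
    have Bq: "cmat B *v vector [0, 1, 0] = vector [of_real (n $ 2 * p $ 3 - n $ 3 * p $ 2),
        of_real (n $ 3 * p $ 1 - n $ 1 * p $ 3), of_real (n $ 1 * p $ 2 - n $ 2 * p $ 1)]"
      by (simp add: B_def cmat_vector_nth)
    show ?thesis
      using directional_derivative_linear[OF F(1), of "vector [0, 1, 0]" 1 B "vector [1, 0, 0]"]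
      unfolding Bp' Bq G_def[symmetric] n by (simp add: algebra_simps)
  qed
  then have b: "b = 0" by (simp add: cubic partial_cubic)
  have "c \<noteq> 0"
  proof
    assume "c = 0"
    moreover have "nonsingular (cubic a b c d e f g h i j)"
      using G(1) by (simp add: cubic elliptic_curve_def)
    ultimately show False
      using nonsingular_cubicD[of a b c d e f g h i j 1 0 0] a b by (simp add: cubic_def)
  qed
  then show ?thesis using that G a b cubic by blast
qed

text \<open>On the tangent z = 0 the cubic is y^2 (d x + g y), so for nonzero \<open>d\<close> the
  tangent meets the curve again, at (-g, d, 0).\<close>

lemma elliptic_curve_nagell_form:
  assumes E: "elliptic_curve (cubic 0 0 c d e f g h i j) (vector [1, 0, 0])" and d: "d \<noteq> 0"
  obtains A B C D H where
    "elliptic_curve (nagell A B C D H) (vector [1, 0, 0])"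
    "isomorphic_over_reals (cubic 0 0 c d e f g h i j) (vector [1, 0, 0])
      (nagell A B C D H) (vector [1, 0, 0])"
proof -
  \<comment> \<open>\<open>\<alpha>\<close> places the third intersection point at (0, 1, 0),
    removing y^3; \<open>\<beta>\<close> makes x = 0 the tangent there, removing y^2 z.\<close>
  define \<alpha> where "\<alpha> = g / d"
  define \<beta> where "\<beta> = (h + c * \<alpha>\<^sup>2 - e * \<alpha>) / d"
  define A B C D H where
    ABC: "A = (e - 2 * \<alpha> * c) / d" "B = (i + 2 * \<alpha> * \<beta> * c - e * \<beta> - f * \<alpha>) / d" "C = - c / d"
    "D = - (f - 2 * \<beta> * c) / d" "H = - (j + c * \<beta>\<^sup>2 - f * \<beta>) / d"
  define S :: "real ^ 3 ^ 3" where
    "S = vector [vector [1, - \<alpha>, - \<beta>], vector [0, 1, 0], vector [0, 0, 1]]"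
  have S: "det S \<noteq> 0" "S *v vector [1, 0, 0] = vector [1, 0, 0]"
    by (simp_all add: S_def det_3 matrix_vector_nth vec_eq_iff forall_3)
  have "of_real (1 / d) * cubic 0 0 c d e f g h i j (cmat S *v v) = nagell A B C D H v" for v
  proof -
    define c' d' e' f' g' h' i' j' where cs: "c' = complex_of_real c" "d' = complex_of_real d"
      "e' = complex_of_real e" "f' = complex_of_real f" "g' = complex_of_real g"
      "h' = complex_of_real h" "i' = complex_of_real i" "j' = complex_of_real j"
    define \<alpha>' \<beta>' A' B' C' D' H' where cs': "\<alpha>' = complex_of_real \<alpha>" "\<beta>' = complex_of_real \<beta>"
      "A' = complex_of_real A" "B' = complex_of_real B" "C' = complex_of_real C"
      "D' = complex_of_real D" "H' = complex_of_real H"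
    define x y z where xyz: "x = v $ 1" "y = v $ 2" "z = v $ 3"
    have d': "d' \<noteq> 0" using d by (simp add: cs)
    have eqs: "d' * \<alpha>' = g'" "d' * \<beta>' = h' + c' * \<alpha>'\<^sup>2 - e' * \<alpha>'" "d' * A' = e' - 2 * \<alpha>' * c'"
      "d' * B' = i' + 2 * \<alpha>' * \<beta>' * c' - e' * \<beta>' - f' * \<alpha>'" "d' * C' = - c'"
      "d' * D' = - (f' - 2 * \<beta>' * c')" "d' * H' = - (j' + c' * \<beta>'\<^sup>2 - f' * \<beta>')"
    proof -
      show "d' * \<alpha>' = g'" using d' by (simp add: cs' cs \<alpha>_def)
      show "d' * \<beta>' = h' + c' * \<alpha>'\<^sup>2 - e' * \<alpha>'" unfolding cs'(2) \<beta>_def using d' by (simp add: cs' cs)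
    qed (unfold cs'(3-) ABC, use d' in \<open>simp_all add: cs' cs\<close>)
    have "d' * (x * y\<^sup>2 + A' * x * y * z + B' * y * z\<^sup>2 - C' * x\<^sup>2 * z - D' * x * z\<^sup>2 - H' * z ^ 3)
      = d' * x * y\<^sup>2 + (d' * A') * x * y * z + (d' * B') * y * z\<^sup>2 - (d' * C') * x\<^sup>2 * z
          - (d' * D') * x * z\<^sup>2 - (d' * H') * z ^ 3"
      by (simp add: algebra_simps)
    also have "\<dots> = c' * (x - \<alpha>' * y - \<beta>' * z)\<^sup>2 * z + d' * (x - \<alpha>' * y - \<beta>' * z) * y\<^sup>2
      + e' * (x - \<alpha>' * y - \<beta>' * z) * y * z + f' * (x - \<alpha>' * y - \<beta>' * z) * z\<^sup>2
      + g' * y ^ 3 + h' * y\<^sup>2 * z + i' * y * z\<^sup>2 + j' * z ^ 3"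
    proof -
      have gh: "g' = d' * \<alpha>'" "h' = d' * \<beta>' - c' * \<alpha>'\<^sup>2 + e' * \<alpha>'" using eqs(1,2) by simp_all
      show ?thesis
        unfolding eqs(3-) gh by (simp add: algebra_simps power2_eq_square power3_eq_cube)
    qed
    finally have "1 / d' * (c' * (x - \<alpha>' * y - \<beta>' * z)\<^sup>2 * z + d' * (x - \<alpha>' * y - \<beta>' * z) * y\<^sup>2
      + e' * (x - \<alpha>' * y - \<beta>' * z) * y * z + f' * (x - \<alpha>' * y - \<beta>' * z) * z\<^sup>2
      + g' * y ^ 3 + h' * y\<^sup>2 * z + i' * y * z\<^sup>2 + j' * z ^ 3)
      = x * y\<^sup>2 + A' * x * y * z + B' * y * z\<^sup>2 - C' * x\<^sup>2 * z - D' * x * z\<^sup>2 - H' * z ^ 3"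
      using d' by (metis (no_types, lifting) divide_self_if mult.assoc mult.left_neutral times_divide_eq_left)
    then show ?thesis
      by (simp add: S_def cmat_vector_nth cubic_def nagell_def Let_def cs cs' xyz)
  qed
  then have "(\<lambda>v. of_real (1 / d) * cubic 0 0 c d e f g h i j (cmat S *v v)) = nagell A B C D H" by blast
  then show ?thesis
    using that elliptic_curve_linear[of "cubic 0 0 c d e f g h i j" S "vector [1, 0, 0]" "1 / d"] S E d
    by simp
qed

text \<open>The tangent z = 0 now cuts out g y^3, so the base point is a flex, and interchanging x
  and y already gives a Weierstrass cubic up to the factor \<open>c\<close>.\<close>

lemma elliptic_curve_flex_weierstrass:
  assumes E: "elliptic_curve (cubic 0 0 c 0 e f g h i j) (vector [1, 0, 0])" and c: "c \<noteq> 0"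
  defines "W \<equiv> weierstrass (e / c) (f / c) (- g / c) (- h / c) (- i / c) (- j / c)"
  shows "elliptic_curve W (vector [0, 1, 0])"
    "isomorphic_over_reals (cubic 0 0 c 0 e f g h i j) (vector [1, 0, 0]) W (vector [0, 1, 0])"
proof -
  define S :: "real ^ 3 ^ 3" where
    "S = vector [vector [0, 1, 0], vector [1, 0, 0], vector [0, 0, 1]]"
  have S: "det S \<noteq> 0" "S *v vector [0, 1, 0] = vector [1, 0, 0]"
    by (simp_all add: S_def det_3 matrix_vector_nth vec_eq_iff forall_3)
  have "(\<lambda>v. of_real (1 / c) * cubic 0 0 c 0 e f g h i j (cmat S *v v)) = W"
    using c by (intro ext)
      (simp add: W_def weierstrass_def S_def cmat_vector_nth cubic_def Let_def add_divide_distrib algebra_simps)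
  then show "elliptic_curve W (vector [0, 1, 0])"
    "isomorphic_over_reals (cubic 0 0 c 0 e f g h i j) (vector [1, 0, 0]) W (vector [0, 1, 0])"
    using elliptic_curve_linear[of "cubic 0 0 c 0 e f g h i j" S "vector [0, 1, 0]" "1 / c"] S E c
    by simp_all
qed

theorem theorem2p3:
  fixes F :: "complex ^ 3 \<Rightarrow> complex" and p :: "real ^ 3"
  assumes "elliptic_curve F p"
  shows "\<exists>a::real. a \<notin> {0, -1, -9} \<and> isomorphic_over_reals F p (E_cubic a) E_base"
proof -
  obtain c d e f g h i j where c: "c \<noteq> 0"
    and E: "elliptic_curve (cubic 0 0 c d e f g h i j) (vector [1, 0, 0])"
    and 1: "isomorphic_over_reals F p (cubic 0 0 c d e f g h i j) (vector [1, 0, 0])"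
    by (rule elliptic_curve_tangent_frame[OF assms])
  have "\<exists>a. a \<notin> {0, -1, -9} \<and> isomorphic_over_reals (cubic 0 0 c d e f g h i j)
      (vector [1, 0, 0]) (E_cubic a) E_base"
  \<comment> \<open>This coefficient decides whether the base point is a flex.\<close>
  proof (cases "d = 0")
    case True
    let ?W = "weierstrass (e / c) (f / c) (- g / c) (- h / c) (- i / c) (- j / c)"
    note W = elliptic_curve_flex_weierstrass[OF E[unfolded True] c]
    have "nonsingular ?W" using W(1) by (simp add: elliptic_curve_def)
    note ns = weierstrass_nonsingularD[OF this]
    obtain a where "a \<notin> {0, -1, -9}"
      "isomorphic_over_reals ?W (vector [0, 1, 0]) (E_cubic a) E_base"
      using weierstrass_isomorphic_E_cubic[OF ns] by metis
    then show ?thesis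
      using isomorphic_over_reals_trans[OF W(2) _ real_form_weierstrass] True by metis
  next
    case False
    obtain A B C D H where N: "elliptic_curve (nagell A B C D H) (vector [1, 0, 0])"
      "isomorphic_over_reals (cubic 0 0 c d e f g h i j) (vector [1, 0, 0])
        (nagell A B C D H) (vector [1, 0, 0])"
      by (rule elliptic_curve_nagell_form[OF E False])
    note W = nagell_isomorphic_weierstrass[OF N(1)]
    obtain a where "a \<notin> {0, -1, -9}"
      "isomorphic_over_reals (weierstrass A B C D H 0) (vector [0, 1, 0]) (E_cubic a) E_base"
      using weierstrass_isomorphic_E_cubic[of C D H 0 A B] W(1,3) by auto
    moreover have "real_form 3 (nagell A B C D H)"
      by (simp add: nagell_def real_form_cubic)
    ultimately show ?thesis
      using isomorphic_over_reals_trans[OF N(2)]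
        isomorphic_over_reals_trans[OF W(2) _ real_form_weierstrass] by metis
  qed
  then show ?thesis
    using isomorphic_over_reals_trans[OF 1 _ real_form_cubic] by metis
qed

end
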